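(* Let $\Gamma$ be a countable discrete group, equipped with a metric $d(g,h)=|gh^{-1}|$ arising from a proper length function $|\cdot|$. Then the following are equivalent: (i) $\Gamma$ has finite decomposition complexity; (ii) the canonical action of $\Gamma$ on its Stone-Čech compactification $\beta\Gamma$ has finite dynamical complexity.
   Context: **Length function.** A proper length function is $|\cdot|:\Gamma\to\mathbb{N}$ with $|g|=0$ iff $g=e$, $|gh|\le|g|+|h|$, $|g^{-1}|=|g|$, and $\{g:|g|\le r\}$ finite for all $r\ge0$. **Finite decomposition complexity.** Let $X$ be a metric space with finite-valued metric $d_X$. A collection $\mathcal{Y}$ of subsets of $X$ is a disjoint family if no two (distinct) elements intersect. $X_{\mathcal{Y}}=\bigsqcup_{Y\in\mathcal{Y}}Y$ carries the metric $d_{\mathcal{Y}}(x,y)=d_X(x,y)$ if $x,y$ lie in a common $Y\in\mathcal{Y}$ and $d_{\mathcal{Y}}(x,y)=\infty$ otherwise. For $Z\subseteq X_{\mathcal{Y}}$, $N_{r,\mathcal{Y}}(Z)=\{y\in X_{\mathcal{Y}}: d_{\mathcal{Y}}(y,z)<r\text{ for some }z\in Z\}$. A disjoint family is uniformly bounded if $\sup_{Y\in\mathcal{Y}}\mathrm{diam}(Y)<\infty$. Given a collection $\mathcal{C}$ of disjoint families of subspaces of $X$, a disjoint family $\mathcal{Y}$ is decomposable over $\mathcal{C}$ if for all $r\ge0$ there are $\mathcal{Z}_0,\mathcal{Z}_1\in\mathcal{C}$ such that every $Y\in\mathcal{Y}$ has a decomposition $Y=Y_0\cup Y_1$, and each $Y_i$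 is a disjoint union $Y_i=\bigsqcup_{j\in J_{Y,i}}Y_{ij}$ with $d(Y_{ij},Y_{ij'})>2r$ for $j\ne j'$ and with $N_{r,\mathcal{Y}}(Y_{ij})\in\mathcal{Z}_i$ for each $j$. $\mathcal{D}_m$ is the smallest collection of disjoint families of subspaces of $X$ containing the uniformly bounded disjoint families and closed under decomposability (a family decomposable over $\mathcal{D}_m$ is in $\mathcal{D}_m$). $X$ has finite decomposition complexity if $\{X\}\in\mathcal{D}_m$. **Finite dynamical complexity.** For an action of $\Gamma$ on a compact Hausdorff space $X$, $\Gamma\ltimes X=\{(gx,g,x):g\in\Gamma,x\in X\}$, topologized as $\Gamma\times X$ via the last two coordinates, with product $(hgx,h,gx)(gx,g,x)=(hgx,hg,x)$, inverse $(gx,g,x)^{-1}=(x,g^{-1},gx)$ and units $(x,e,x)$ (identified with $x\in X$). A subgroupoid is a subset closed under products of composable pairs, inverses, and passing to the units $(x,e,x),(gx,e,gx)$ of an element $(gx,g,x)$; $G^{(0)}$ denotes the units of $G$. An open subgroupoid $G$ is decomposable over a set $\mathcal{C}$ of open subgroupoids if for all $r\ge0$ there is an open cover $G^{(0)}=U_0\cup U_1$ such that for each $i$ the subgroupoid generated by $\{(gx,g,x)\in G:x\in U_i,|g|\le r\}$ is in $\mathcal{C}$. $\mathcal{D}$ is the smallest set of open subgroupoids of $\Gamma\ltimes X$ containing all relatively compact open subgroupoids and closed under decomposability. The action has finite dynamical complexity if $\Gamma\ltimes X\in\mathcal{D}$. *)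

theory Defs
  imports "HOL-Analysis.Analysis" "HOL-Algebra.Group_Action" "HOL-Library.Disjoint_Sets"
begin

section \<open>Length functions\<close>

locale proper_length_function = group G
  for G (structure) and len :: "'a \<Rightarrow> nat" +
  assumes len_eq_0_iff: "g \<in> carrier G \<Longrightarrow> len g = 0 \<longleftrightarrow> g = \<one>"
    and len_mult_le: "\<lbrakk>g \<in> carrier G; h \<in> carrier G\<rbrakk> \<Longrightarrow> len (g \<otimes> h) \<le> len g + len h"
    and len_inv: "g \<in> carrier G \<Longrightarrow> len (inv g) = len g"
    and finite_len_le: "finite {g \<in> carrier G. len g \<le> r}"

text \<open>The locale \<^locale>\<open>Metric_space\<close> requires nonnegativity and symmetry at all arguments, hence
  the value 0 outside of the group.\<close>

definition length_dist :: "('a, 'b) monoid_scheme \<Rightarrow> ('a \<Rightarrow> nat) \<Rightarrow> 'a \<Rightarrow> 'a \<Rightarrow> real" where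
  "length_dist G len g h =
    (if g \<in> carrier G \<and> h \<in> carrier G then real (len (g \<otimes>\<^bsub>G\<^esub> inv\<^bsub>G\<^esub> h)) else 0)"

lemma (in proper_length_function) Metric_space_length_dist:
  "Metric_space (carrier G) (length_dist G len)"
proof
  fix x y z
  show "0 \<le> length_dist G len x y"
    by (simp add: length_dist_def)
  show "length_dist G len x y = length_dist G len y x"
    using len_inv[of "x \<otimes> inv y"] by (auto simp: length_dist_def inv_mult_group)
  assume x: "x \<in> carrier G" and y: "y \<in> carrier G"
  show "length_dist G len x y = 0 \<longleftrightarrow> x = y"
  proof -
    have "x \<otimes> inv y = \<one> \<longleftrightarrow> x = y"
      using x y by (metis inv_closed inv_equality inv_inv r_inv)
    then show ?thesis
      using x y len_eq_0_iff[of "x \<otimes> inv y"] by (simp add: length_dist_def)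
  qed
  assume z: "z \<in> carrier G"
  have "x \<otimes> inv z = (x \<otimes> inv y) \<otimes> (y \<otimes> inv z)"
    using x y z by (metis inv_closed inv_solve_left m_assoc m_closed)
  then show "length_dist G len x z \<le> length_dist G len x y + length_dist G len y z"
    using x y z len_mult_le[of "x \<otimes> inv y" "y \<otimes> inv z"]
    by (simp add: length_dist_def flip: of_nat_add)
qed


section \<open>Finite decomposition complexity\<close>

context Metric_space
begin

definition disjoint_subspaces :: "'a set set \<Rightarrow> bool" where
  "disjoint_subspaces \<Y> \<longleftrightarrow> \<Y> \<subseteq> Pow M \<and> disjoint \<Y>"

definition mdiam :: "'a set \<Rightarrow> ereal" where
  "mdiam Y = (SUP x\<in>Y. SUP y\<in>Y. ereal (d x y))"

definition uniformly_bounded :: "'a set set \<Rightarrow> bool" where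
  "uniformly_bounded \<Y> \<longleftrightarrow> (SUP Y\<in>\<Y>. mdiam Y) < \<infinity>"

definition family_dist :: "'a set set \<Rightarrow> 'a \<Rightarrow> 'a \<Rightarrow> ereal" where
  "family_dist \<Y> x y = (if \<exists>Y\<in>\<Y>. x \<in> Y \<and> y \<in> Y then ereal (d x y) else \<infinity>)"

definition family_nbhd :: "real \<Rightarrow> 'a set set \<Rightarrow> 'a set \<Rightarrow> 'a set" where
  "family_nbhd r \<Y> Z = {y \<in> \<Union>\<Y>. \<exists>z\<in>Z. family_dist \<Y> y z < ereal r}"

definition set_mdist :: "'a set \<Rightarrow> 'a set \<Rightarrow> ereal" where
  "set_mdist A B = (INF x\<in>A. INF y\<in>B. ereal (d x y))"

text \<open>\<open>Y'\<close> is one of the two halves of a member of \<open>\<Y>\<close>, \<open>\<W>\<close> is the set of its pieces.\<close>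

definition separated_pieces :: "real \<Rightarrow> 'a set set \<Rightarrow> 'a set set \<Rightarrow> 'a set \<Rightarrow> bool" where
  "separated_pieces r \<Y> \<Z> Y' \<longleftrightarrow>
    (\<exists>\<W>. Y' = \<Union>\<W> \<and> disjoint \<W> \<and>
      (\<forall>A\<in>\<W>. \<forall>B\<in>\<W>. A \<noteq> B \<longrightarrow> ereal (2 * r) < set_mdist A B) \<and>
      (\<forall>A\<in>\<W>. family_nbhd r \<Y> A \<in> \<Z>))"

definition decomposable_over :: "'a set set set \<Rightarrow> 'a set set \<Rightarrow> bool" where
  "decomposable_over \<C> \<Y> \<longleftrightarrow>
    (\<forall>r\<ge>0. \<exists>\<Z>0\<in>\<C>. \<exists>\<Z>1\<in>\<C>. \<forall>Y\<in>\<Y>. \<exists>Y0 Y1. Y = Y0 \<union> Y1 \<and>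
      separated_pieces r \<Y> \<Z>0 Y0 \<and> separated_pieces r \<Y> \<Z>1 Y1)"

lemma decomposable_over_mono [mono]:
  "\<C> \<subseteq> \<C>' \<Longrightarrow> decomposable_over \<C> \<Y> \<longrightarrow> decomposable_over \<C>' \<Y>"
  unfolding decomposable_over_def by (meson subsetD)

inductive_set decomposition_class :: "'a set set set" where
  bounded: "\<lbrakk>disjoint_subspaces \<Y>; uniformly_bounded \<Y>\<rbrakk> \<Longrightarrow> \<Y> \<in> decomposition_class"
| decomposable: "\<lbrakk>disjoint_subspaces \<Y>; decomposable_over decomposition_class \<Y>\<rbrakk>
    \<Longrightarrow> \<Y> \<in> decomposition_class"
monos decomposable_over_mono

definition finite_decomposition_complexity :: bool where
  "finite_decomposition_complexity \<longleftrightarrow> {M} \<in> decomposition_class"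

end


section \<open>Finite dynamical complexity\<close>

locale compact_Hausdorff_action = group_action G "topspace X" \<phi>
  for G (structure) and X :: "'x topology" and \<phi> :: "'a \<Rightarrow> 'x \<Rightarrow> 'x" +
  assumes compact: "compact_space X"
    and Hausdorff: "Hausdorff_space X"
    and continuous: "g \<in> carrier G \<Longrightarrow> continuous_map X X (\<phi> g)"
begin

definition arrows :: "('x \<times> 'a \<times> 'x) set" where
  "arrows = {(\<phi> g x, g, x) | g x. g \<in> carrier G \<and> x \<in> topspace X}"

definition arrow_topology :: "('x \<times> 'a \<times> 'x) topology" where
  "arrow_topology = pullback_topology arrows snd (prod_topology (discrete_topology (carrier G)) X)"

definition subgroupoid :: "('x \<times> 'a \<times> 'x) set \<Rightarrow> bool" where
  "subgroupoid H \<longleftrightarrow> H \<subseteq> arrows \<and>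
    (\<forall>z h y g x. (z, h, y) \<in> H \<and> (y, g, x) \<in> H \<longrightarrow> (z, h \<otimes> g, x) \<in> H) \<and>
    (\<forall>y g x. (y, g, x) \<in> H \<longrightarrow> (x, inv g, y) \<in> H) \<and>
    (\<forall>y g x. (y, g, x) \<in> H \<longrightarrow> (x, \<one>, x) \<in> H \<and> (y, \<one>, y) \<in> H)"

definition open_subgroupoid :: "('x \<times> 'a \<times> 'x) set \<Rightarrow> bool" where
  "open_subgroupoid H \<longleftrightarrow> subgroupoid H \<and> openin arrow_topology H"

definition relatively_compact :: "('x \<times> 'a \<times> 'x) set \<Rightarrow> bool" where
  "relatively_compact H \<longleftrightarrow> compactin arrow_topology (arrow_topology closure_of H)"

definition units_of_subgroupoid :: "('x \<times> 'a \<times> 'x) set \<Rightarrow> 'x set" where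
  "units_of_subgroupoid H = {x. (x, \<one>, x) \<in> H}"

definition generated_subgroupoid :: "('x \<times> 'a \<times> 'x) set \<Rightarrow> ('x \<times> 'a \<times> 'x) set" where
  "generated_subgroupoid S = \<Inter>{H. subgroupoid H \<and> S \<subseteq> H}"

definition decomposable_over ::
    "('a \<Rightarrow> nat) \<Rightarrow> ('x \<times> 'a \<times> 'x) set set \<Rightarrow> ('x \<times> 'a \<times> 'x) set \<Rightarrow> bool" where
  "decomposable_over len \<C> H \<longleftrightarrow>
    (\<forall>r::real. r \<ge> 0 \<longrightarrow> (\<exists>U0 U1. openin X U0 \<and> openin X U1 \<and>
      units_of_subgroupoid H = U0 \<union> U1 \<and>
      (\<forall>U\<in>{U0, U1}.
        generated_subgroupoid {(y, g, x) \<in> H. x \<in> U \<and> real (len g) \<le> r} \<in> \<C>)))"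

lemma decomposable_over_mono [mono]:
  "\<C> \<subseteq> \<C>' \<Longrightarrow> decomposable_over len \<C> H \<longrightarrow> decomposable_over len \<C>' H"
  unfolding decomposable_over_def by (meson subsetD)

inductive_set dynamical_class :: "('a \<Rightarrow> nat) \<Rightarrow> ('x \<times> 'a \<times> 'x) set set"
  for len :: "'a \<Rightarrow> nat" where
  relatively_compact:
    "\<lbrakk>open_subgroupoid H; relatively_compact H\<rbrakk> \<Longrightarrow> H \<in> dynamical_class len"
| decomposable: "\<lbrakk>open_subgroupoid H; decomposable_over len (dynamical_class len) H\<rbrakk>
    \<Longrightarrow> H \<in> dynamical_class len"
monos decomposable_over_mono

definition finite_dynamical_complexity :: "('a \<Rightarrow> nat) \<Rightarrow> bool" where
  "finite_dynamical_complexity len \<longleftrightarrow> arrows \<in> dynamical_class len"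

end


section \<open>The Stone--Cech compactification of a discrete space\<close>

text \<open>The compactification of a discrete space \<open>S\<close> is realised as the space of ultrafilters on \<open>S\<close>;
  a point \<open>x \<in> S\<close> corresponds to the filter \<^term>\<open>principal {x}\<close>. The lemmas below show
  that this is a compact Hausdorff space with the universal property of the compactification.\<close>

definition ultrafilter :: "'a filter \<Rightarrow> bool" where
  "ultrafilter F \<longleftrightarrow> F \<noteq> bot \<and> (\<forall>P. eventually P F \<or> eventually (\<lambda>x. \<not> P x) F)"

definition ultrafilters_on :: "'a set \<Rightarrow> 'a filter set" where
  "ultrafilters_on S = {F. ultrafilter F \<and> eventually (\<lambda>x. x \<in> S) F}"

definition stone_cech :: "'a set \<Rightarrow> 'a filter topology" where
  "stone_cech S = topology_generated_by
    {{F \<in> ultrafilters_on S. eventually (\<lambda>x. x \<in> A) F} | A. A \<subseteq> S}"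

text \<open>Left translation by \<open>g\<close> extends to ultrafilters as the push-forward.\<close>

definition stone_cech_action :: "('a, 'b) monoid_scheme \<Rightarrow> 'a \<Rightarrow> 'a filter \<Rightarrow> 'a filter" where
  "stone_cech_action G g =
    (\<lambda>F \<in> ultrafilters_on (carrier G). filtermap (\<lambda>x. g \<otimes>\<^bsub>G\<^esub> x) F)"

lemma ultrafilter_not_iff:
  assumes "ultrafilter F"
  shows "eventually (\<lambda>x. \<not> P x) F \<longleftrightarrow> \<not> eventually P F"
  using assms eventually_conj[of P F "\<lambda>x. \<not> P x"]
  by (auto simp: ultrafilter_def eventually_False)

lemma ex_ultrafilter_le:
  assumes "F \<noteq> bot"
  shows "\<exists>U\<le>F. ultrafilter U"
proof -
  define A where "A = {G. G \<noteq> bot \<and> G \<le> F}"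
  let ?R = "\<lambda>G H :: 'a filter. H \<le> G"
  have "\<exists>U\<in>A. \<forall>G\<in>A. ?R U G \<longrightarrow> G = U"
  proof (rule predicate_Zorn)
    show "partial_order_on A (relation_of ?R A)"
      by (rule partial_order_on_relation_ofI) auto
    fix C assume C: "C \<in> Chains (relation_of ?R A)"
    then have CA: "C \<subseteq> A" and lin: "\<And>G H. \<lbrakk>G \<in> C; H \<in> C\<rbrakk> \<Longrightarrow> G \<le> H \<or> H \<le> G"
      by (auto simp: Chains_def relation_of_def)
    show "\<exists>u\<in>A. \<forall>a\<in>C. u \<le> a"
    proof (cases "C = {}")
      case True
      then show ?thesis using assms by (auto simp: A_def)
    next
      case False
      have base: "\<exists>x\<in>C. x \<le> inf G H" if "G \<in> C" "H \<in> C" for G H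
        using lin[OF that] that by (metis inf.absorb1 inf.absorb2 order_refl)
      have "Inf C \<noteq> bot"
      proof
        assume "Inf C = bot"
        then have "eventually (\<lambda>_. False) (Inf C)" by simp
        then obtain G where "G \<in> C" "eventually (\<lambda>_. False) G"
          using eventually_Inf_base[OF False base] by blast
        then show False using CA by (auto simp: A_def eventually_False)
      qed
      moreover have "Inf C \<le> F"
      proof -
        obtain G where "G \<in> C" using False by blast
        then have "Inf C \<le> G" "G \<le> F" using CA by (auto simp: A_def Inf_lower)
        then show ?thesis by (rule order_trans)
      qed
      ultimately have "Inf C \<in> A" by (simp add: A_def)
      then show ?thesis by (metis Inf_lower)
    qed
  qed
  then obtain U where U: "U \<noteq> bot" "U \<le> F" and min: "\<And>G. \<lbrakk>G \<noteq> bot; G \<le> U\<rbrakk> \<Longrightarrow> G = U"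
    unfolding A_def by (smt (verit, best) mem_Collect_eq order_trans)
  have "eventually P U \<or> eventually (\<lambda>x. \<not> P x) U" for P
  proof (cases "inf U (principal {x. P x}) = bot")
    case True
    then have "eventually (\<lambda>_. False) (inf U (principal {x. P x}))" by simp
    then show ?thesis by (simp add: eventually_inf_principal)
  next
    case False
    then have "inf U (principal {x. P x}) = U" by (simp add: min)
    moreover have "eventually P (inf U (principal {x. P x}))"
      by (simp add: eventually_inf_principal)
    ultimately show ?thesis by simp
  qed
  with U show ?thesis by (auto simp: ultrafilter_def)
qed

lemma openin_stone_cech:
  "openin (stone_cech S) U \<longleftrightarrow> U \<subseteq> ultrafilters_on S \<and>
    (\<forall>F\<in>U. \<exists>A\<subseteq>S. eventually (\<lambda>x. x \<in> A) F \<and>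
      {F' \<in> ultrafilters_on S. eventually (\<lambda>x. x \<in> A) F'} \<subseteq> U)"
  (is "_ \<longleftrightarrow> ?P U")
proof
  let ?B = "{{F \<in> ultrafilters_on S. eventually (\<lambda>x. x \<in> A) F} | A. A \<subseteq> S}"
  assume "openin (stone_cech S) U"
  then have "generate_topology_on ?B U"
    by (simp add: stone_cech_def openin_topology_generated_by_iff)
  then show "?P U"
  proof induction
    case (Int U V)
    have "\<exists>A\<subseteq>S. eventually (\<lambda>x. x \<in> A) F \<and>
      {F' \<in> ultrafilters_on S. eventually (\<lambda>x. x \<in> A) F'} \<subseteq> U \<inter> V" if F: "F \<in> U \<inter> V" for F
    proof -
      obtain A B where "A \<subseteq> S" "eventually (\<lambda>x. x \<in> A) F"
          "{F' \<in> ultrafilters_on S. eventually (\<lambda>x. x \<in> A) F'} \<subseteq> U"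
          "B \<subseteq> S" "eventually (\<lambda>x. x \<in> B) F"
          "{F' \<in> ultrafilters_on S. eventually (\<lambda>x. x \<in> B) F'} \<subseteq> V"
        using Int.IH F by (meson IntD1 IntD2)
      then show ?thesis
        by (intro exI[of _ "A \<inter> B"]) (auto simp: eventually_conj_iff)
    qed
    then show ?case using Int.IH by blast
  next
    case (UN K)
    then show ?case by (smt (verit, best) Union_iff subset_iff)
  next
    case (Basis s)
    then show ?case by auto
  qed simp
next
  assume U: "?P U"
  have "openin (stone_cech S)
      {F' \<in> ultrafilters_on S. eventually (\<lambda>x. x \<in> A) F'}" if "A \<subseteq> S" for A
    unfolding stone_cech_def by (rule topology_generated_by_Basis) (use that in blast)
  then show "openin (stone_cech S) U"
    using U by (subst openin_subopen) (smt (verit) mem_Collect_eq subset_iff)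
qed

lemma topspace_stone_cech: "topspace (stone_cech S) = ultrafilters_on S"
proof
  show "topspace (stone_cech S) \<subseteq> ultrafilters_on S"
    using openin_stone_cech openin_topspace by blast
  have "openin (stone_cech S) (ultrafilters_on S)"
    unfolding openin_stone_cech by (auto simp: ultrafilters_on_def)
  then show "ultrafilters_on S \<subseteq> topspace (stone_cech S)"
    by (rule openin_subset)
qed

lemma compact_space_stone_cech: "compact_space (stone_cech S)"
  unfolding compact_space_alt
proof (intro allI impI, elim conjE)
  fix \<U>
  assume op: "\<forall>U\<in>\<U>. openin (stone_cech S) U" and cov: "topspace (stone_cech S) \<subseteq> \<Union>\<U>"
  let ?b = "\<lambda>A. {F \<in> ultrafilters_on S. eventually (\<lambda>x. x \<in> A) F}"
  define \<A> where "\<A> = {A. A \<subseteq> S \<and> (\<exists>U\<in>\<U>. ?b A \<subseteq> U)}"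
  define F where "F = (INF A\<in>insert {} \<A>. principal (S - A))"
  show "\<exists>\<F>. finite \<F> \<and> \<F> \<subseteq> \<U> \<and> topspace (stone_cech S) \<subseteq> \<Union>\<F>"
  proof (cases "F = bot")
    case True
    then obtain \<X> where X: "\<X> \<subseteq> insert {} \<A>" "finite \<X>"
        and bot: "(INF A\<in>\<X>. principal (S - A)) = bot"
      using INF_filter_not_bot[of "insert {} \<A>" "\<lambda>A. principal (S - A)"] unfolding F_def by blast
    have "\<forall>A\<in>\<X> - {{}}. \<exists>U\<in>\<U>. ?b A \<subseteq> U" using X(1) unfolding \<A>_def by blast
    then obtain u where u: "\<And>A. A \<in> \<X> - {{}} \<Longrightarrow> u A \<in> \<U> \<and> ?b A \<subseteq> u A" by metis
    have "topspace (stone_cech S) \<subseteq> \<Union>(u ` (\<X> - {{}}))"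
    proof
      fix G assume "G \<in> topspace (stone_cech S)"
      then have G: "G \<in> ultrafilters_on S" and ultra: "ultrafilter G"
        by (auto simp: topspace_stone_cech ultrafilters_on_def)
      have "\<exists>A\<in>\<X>. eventually (\<lambda>x. x \<in> A) G"
      proof (rule ccontr)
        assume "\<not> ?thesis"
        then have "\<forall>A\<in>\<X>. eventually (\<lambda>x. x \<notin> A) G"
          using ultrafilter_not_iff[OF ultra] by blast
        then have "\<forall>A\<in>\<X>. G \<le> principal (S - A)"
          using G by (auto simp: le_principal ultrafilters_on_def eventually_conj_iff)
        then have "G \<le> (INF A\<in>\<X>. principal (S - A))" by (simp add: INF_greatest)
        then show False using ultra bot by (simp add: ultrafilter_def bot_unique)
      qed
      then obtain A where A: "A \<in> \<X>" "eventually (\<lambda>x. x \<in> A) G" by blast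
      then have "A \<noteq> {}" using ultra by (auto simp: ultrafilter_def)
      then show "G \<in> \<Union>(u ` (\<X> - {{}}))" using A u[of A] G by blast
    qed
    then show ?thesis
      using X(2) u by (intro exI[of _ "u ` (\<X> - {{}})"]) auto
  next
    case False
    then obtain G where G: "G \<le> F" "ultrafilter G" using ex_ultrafilter_le by blast
    have le: "G \<le> principal (S - A)" if "A \<in> insert {} \<A>" for A
      using G(1) that unfolding F_def by (meson INF_lower order_trans)
    from le[of "{}"] have GS: "G \<in> ultrafilters_on S"
      using G(2) by (simp add: ultrafilters_on_def le_principal)
    then obtain U where "U \<in> \<U>" "G \<in> U" using cov by (auto simp: topspace_stone_cech)
    then obtain A where A: "A \<subseteq> S" "eventually (\<lambda>x. x \<in> A) G" "?b A \<subseteq> U"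
      using op unfolding openin_stone_cech by meson
    then have "A \<in> \<A>" using \<open>U \<in> \<U>\<close> by (auto simp: \<A>_def)
    then have "eventually (\<lambda>x. x \<notin> A) G"
      using le[of A] by (auto simp: le_principal elim: eventually_mono)
    then show ?thesis using A(2) ultrafilter_not_iff[OF G(2)] by blast
  qed
qed

lemma Hausdorff_space_stone_cech: "Hausdorff_space (stone_cech S)"
  unfolding Hausdorff_space_def topspace_stone_cech
proof (intro allI impI, elim conjE)
  fix F G assume F: "F \<in> ultrafilters_on S" and G: "G \<in> ultrafilters_on S" and "F \<noteq> G"
  let ?b = "\<lambda>A. {F \<in> ultrafilters_on S. eventually (\<lambda>x. x \<in> A) F}"
  have uF: "ultrafilter F" and uG: "ultrafilter G"
    and SF: "eventually (\<lambda>x. x \<in> S) F" and SG: "eventually (\<lambda>x. x \<in> S) G"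
    using F G by (auto simp: ultrafilters_on_def)
  obtain P where P: "eventually P F" "\<not> eventually P G"
    using \<open>F \<noteq> G\<close> ultrafilter_not_iff[OF uF] ultrafilter_not_iff[OF uG]
    unfolding filter_eq_iff by (metis (no_types, lifting))
  have op: "openin (stone_cech S) (?b A)" if "A \<subseteq> S" for A
    unfolding openin_stone_cech using that by auto
  have "F \<in> ?b {x \<in> S. P x}" using F P(1) SF by (simp add: eventually_conj_iff)
  moreover have "G \<in> ?b {x \<in> S. \<not> P x}"
    using G P(2) SG ultrafilter_not_iff[OF uG] by (simp add: eventually_conj_iff)
  moreover have "disjnt (?b {x \<in> S. P x}) (?b {x \<in> S. \<not> P x})"
    by (auto simp: disjnt_def ultrafilters_on_def ultrafilter_not_iff eventually_conj_iff)
  ultimately show "\<exists>U V. openin (stone_cech S) U \<and> openin (stone_cech S) V \<and>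
      F \<in> U \<and> G \<in> V \<and> disjnt U V"
    using op[of "{x \<in> S. P x}"] op[of "{x \<in> S. \<not> P x}"] by blast
qed

lemma principal_in_ultrafilters_on: "x \<in> S \<Longrightarrow> principal {x} \<in> ultrafilters_on S"
  by (auto simp: ultrafilters_on_def ultrafilter_def eventually_principal principal_eq_bot_iff)

lemma stone_cech_dense:
  "stone_cech S closure_of ((\<lambda>x. principal {x}) ` S) = topspace (stone_cech S)"
proof -
  have "F \<in> stone_cech S closure_of ((\<lambda>x. principal {x}) ` S)" if "F \<in> ultrafilters_on S" for F
    unfolding in_closure_of topspace_stone_cech
  proof (intro conjI allI impI that, elim conjE)
    fix T assume "F \<in> T" "openin (stone_cech S) T"
    then obtain A where A: "A \<subseteq> S" "eventually (\<lambda>x. x \<in> A) F"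
        "{F' \<in> ultrafilters_on S. eventually (\<lambda>x. x \<in> A) F'} \<subseteq> T"
      unfolding openin_stone_cech by meson
    have "F \<noteq> bot" using that by (simp add: ultrafilters_on_def ultrafilter_def)
    then obtain x where x: "x \<in> A" using eventually_happens'[OF _ A(2)] by blast
    then have "x \<in> S" using A(1) by blast
    then have "principal {x} \<in> T"
      using x by (intro subsetD[OF A(3)]) (simp add: eventually_principal principal_in_ultrafilters_on)
    then show "\<exists>y. y \<in> (\<lambda>x. principal {x}) ` S \<and> y \<in> T"
      using \<open>x \<in> S\<close> by blast
  qed
  then show ?thesis
    using closure_of_subset_topspace by (fastforce simp: topspace_stone_cech)
qed

lemma embedding_map_stone_cech:
  "embedding_map (discrete_topology S) (stone_cech S) (\<lambda>x. principal {x})"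
proof (rule injective_open_imp_embedding_map)
  show "inj_on (\<lambda>x. principal {x}) (topspace (discrete_topology S))"
    by (auto simp: inj_on_def)
  show "continuous_map (discrete_topology S) (stone_cech S) (\<lambda>x. principal {x})"
    by (auto simp: topspace_stone_cech principal_in_ultrafilters_on)
  show "open_map (discrete_topology S) (stone_cech S) (\<lambda>x. principal {x})"
    unfolding open_map_def
  proof (intro allI impI)
    fix A assume "openin (discrete_topology S) A"
    then have "A \<subseteq> S" by simp
    have "F = principal {x}" if "F \<in> ultrafilters_on S" "eventually (\<lambda>y. y \<in> {x}) F" for F x
    proof (rule filter_eq_iff[THEN iffD2], intro allI)
      fix P
      have "F \<noteq> bot" using that by (simp add: ultrafilters_on_def ultrafilter_def)
      have "eventually P F \<longleftrightarrow> eventually (\<lambda>_. P x) F"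
        by (rule eventually_subst) (use that(2) in \<open>auto elim: eventually_mono\<close>)
      then show "eventually P F \<longleftrightarrow> eventually P (principal {x})"
        using \<open>F \<noteq> bot\<close> by (simp add: eventually_principal)
    qed
    then have sub: "{F' \<in> ultrafilters_on S. eventually (\<lambda>y. y \<in> {x}) F'} \<subseteq> {principal {x}}" for x
      by blast
    have "\<exists>B\<subseteq>S. eventually (\<lambda>x. x \<in> B) F \<and>
        {F' \<in> ultrafilters_on S. eventually (\<lambda>x. x \<in> B) F'} \<subseteq> (\<lambda>x. principal {x}) ` A"
      if F: "F \<in> (\<lambda>x. principal {x}) ` A" for F
    proof -
      obtain x where x: "x \<in> A" "F = principal {x}" using F by blast
      then show ?thesis
        using \<open>A \<subseteq> S\<close> sub[of x] by (intro exI[of _ "{x}"]) (auto simp: eventually_principal)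
    qed
    then show "openin (stone_cech S) ((\<lambda>x. principal {x}) ` A)"
      unfolding openin_stone_cech
      using \<open>A \<subseteq> S\<close> principal_in_ultrafilters_on[of _ S] by (intro conjI ballI) auto
  qed
qed

lemma stone_cech_extension:
  assumes K: "compact_space K" "Hausdorff_space K" and f: "f \<in> S \<rightarrow> topspace K"
  shows "\<exists>h. continuous_map (stone_cech S) K h \<and> (\<forall>x\<in>S. h (principal {x}) = f x)"
proof -
  have "\<exists>k. limitin K f k F" if F: "F \<in> ultrafilters_on S" for F
  proof (rule ccontr)
    assume no: "\<nexists>k. limitin K f k F"
    have u: "ultrafilter F" and SF: "eventually (\<lambda>x. x \<in> S) F"
      using F by (auto simp: ultrafilters_on_def)
    have "\<forall>k\<in>topspace K. \<exists>U. openin K U \<and> k \<in> U \<and> \<not> eventually (\<lambda>x. f x \<in> U) F"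
      using no by (auto simp: limitin_def)
    then obtain U where U: "\<And>k. k \<in> topspace K \<Longrightarrow>
        openin K (U k) \<and> k \<in> U k \<and> \<not> eventually (\<lambda>x. f x \<in> U k) F" by metis
    then obtain \<F> where \<F>: "finite \<F>" "\<F> \<subseteq> U ` topspace K" "topspace K \<subseteq> \<Union>\<F>"
      using K(1) unfolding compact_space_alt
    proof -
      have "\<forall>V\<in>U ` topspace K. openin K V" "topspace K \<subseteq> \<Union>(U ` topspace K)" using U by blast+
      then show ?thesis using that K(1) unfolding compact_space_alt by meson
    qed
    have "\<forall>V\<in>\<F>. eventually (\<lambda>x. f x \<notin> V) F"
      using U \<F>(2) ultrafilter_not_iff[OF u] by blast
    then have "eventually (\<lambda>x. \<forall>V\<in>\<F>. f x \<notin> V) F"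
      using \<F>(1) by (simp add: eventually_ball_finite)
    then have "eventually (\<lambda>x. False) F"
      using SF by eventually_elim (use \<F>(3) f in fastforce)
    then show False using u by (simp add: ultrafilter_def)
  qed
  then obtain h where h: "\<And>F. F \<in> ultrafilters_on S \<Longrightarrow> limitin K f (h F) F" by metis
  have "continuous_map (stone_cech S) K h"
    unfolding continuous_map_atin
  proof
    fix F assume F: "F \<in> topspace (stone_cech S)"
    have "\<exists>V. openin (stone_cech S) V \<and> F \<in> V \<and> h ` V \<subseteq> U" if U: "openin K U" "h F \<in> U" for U
    proof -
      have reg: "regular_space K"
        using K by (simp add: compact_Hausdorff_or_regular_imp_normal_space
            compact_Hausdorff_imp_regular_space)
      have "limitin K f (h F) F" using h F by (simp add: topspace_stone_cech)
      obtain W C where W: "openin K W" "closedin K C" "h F \<in> W" "W \<subseteq> C" "C \<subseteq> U"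
        using reg U unfolding neighbourhood_base_of_closedin[symmetric]
        by (metis neighbourhood_base_of)
      define A where "A = {x \<in> S. f x \<in> W}"
      let ?V = "{F' \<in> ultrafilters_on S. eventually (\<lambda>x. x \<in> A) F'}"
      have "eventually (\<lambda>x. f x \<in> W) F"
        using \<open>limitin K f (h F) F\<close> W by (simp add: limitin_def)
      then have "F \<in> ?V"
        using F by (auto simp: A_def topspace_stone_cech ultrafilters_on_def eventually_conj_iff)
      moreover have "openin (stone_cech S) ?V"
        unfolding openin_stone_cech
        by (intro conjI ballI exI[of _ A]) (auto simp: A_def)
      moreover have "h G \<in> U" if G: "G \<in> ?V" for G
      proof (rule ccontr)
        assume "h G \<notin> U"
        have lim: "limitin K f (h G) G" using h G by simp
        then have "eventually (\<lambda>x. f x \<in> topspace K - C) G"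
          using W \<open>h G \<notin> U\<close> by (auto simp: limitin_def closedin_def)
        moreover have "eventually (\<lambda>x. x \<in> A) G" using G by simp
        ultimately have "eventually (\<lambda>x. False) G"
          by eventually_elim (use W in \<open>auto simp: A_def\<close>)
        then show False using G by (simp add: ultrafilters_on_def ultrafilter_def)
      qed
      ultimately show ?thesis by blast
    qed
    then show "limitin K h (h F) (atin (stone_cech S) F)"
      using F h[of F] unfolding limitin_atin topspace_stone_cech
      by (metis (no_types, lifting) Diff_subset image_mono limitin_topspace order_trans)
  qed
  moreover have "h (principal {x}) = f x" if x: "x \<in> S" for x
  proof (rule limitin_Hausdorff_unique[OF h[OF principal_in_ultrafilters_on[OF x]] _ _ K(2)])
    show "limitin K f (f x) (principal {x})"
      using f x by (auto simp: limitin_def eventually_principal)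
    show "\<not> trivial_limit (principal {x})"
      by (simp add: principal_eq_bot_iff)
  qed
  ultimately show ?thesis by blast
qed

lemma filtermap_eventually_cong:
  assumes "eventually (\<lambda>x. f x = g x) F"
  shows "filtermap f F = filtermap g F"
  unfolding filter_eq_iff eventually_filtermap
proof
  fix P
  show "eventually (\<lambda>x. P (f x)) F \<longleftrightarrow> eventually (\<lambda>x. P (g x)) F"
    by (rule eventually_subst) (use assms in \<open>auto elim: eventually_mono\<close>)
qed

lemma (in group) stone_cech_action_principal:
  "\<lbrakk>g \<in> carrier G; x \<in> carrier G\<rbrakk>
    \<Longrightarrow> stone_cech_action G g (principal {x}) = principal {g \<otimes> x}"
  by (simp add: stone_cech_action_def principal_in_ultrafilters_on filtermap_principal)

lemma (in group) compact_Hausdorff_action_stone_cech: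
  "compact_Hausdorff_action G (stone_cech (carrier G)) (stone_cech_action G)"
proof -
  let ?E = "ultrafilters_on (carrier G)"
  have closed: "stone_cech_action G g F \<in> ?E" if "g \<in> carrier G" "F \<in> ?E" for g F
    using that
    by (auto simp: stone_cech_action_def ultrafilters_on_def ultrafilter_def eventually_filtermap
        filtermap_bot_iff elim: eventually_mono)
  have comp: "stone_cech_action G (g \<otimes> h) F = stone_cech_action G g (stone_cech_action G h F)"
    if "g \<in> carrier G" "h \<in> carrier G" "F \<in> ?E" for g h F
  proof -
    have "filtermap (\<lambda>x. g \<otimes> h \<otimes> x) F = filtermap (\<lambda>x. g \<otimes> (h \<otimes> x)) F"
      using that by (intro filtermap_eventually_cong) (auto simp: ultrafilters_on_def m_assoc elim: eventually_mono)
    then show ?thesis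
      using that closed[of h F] by (simp add: stone_cech_action_def filtermap_filtermap)
  qed
  have one: "stone_cech_action G \<one> F = F" if "F \<in> ?E" for F
  proof -
    have "filtermap (\<lambda>x. \<one> \<otimes> x) F = filtermap (\<lambda>x. x) F"
      using that by (intro filtermap_eventually_cong) (auto simp: ultrafilters_on_def elim: eventually_mono)
    then show ?thesis using that by (simp add: stone_cech_action_def filtermap_ident)
  qed
  have bij: "stone_cech_action G g \<in> Bij ?E" if g: "g \<in> carrier G" for g
  proof -
    have "bij_betw (stone_cech_action G g) ?E ?E"
      using g closed comp[symmetric] one
      by (intro bij_betwI[where g = "stone_cech_action G (inv g)"]) auto
    then show ?thesis by (simp add: Bij_def stone_cech_action_def)
  qed
  have act: "group_action G ?E (stone_cech_action G)"
  proof (intro group_action.intro group_hom.intro group_hom_axioms.intro)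
    show "group G" by (rule is_group)
    show "group (BijGroup ?E)" by (rule group_BijGroup)
    show "stone_cech_action G \<in> hom G (BijGroup ?E)"
    proof (rule homI)
      fix g h assume gh: "g \<in> carrier G" "h \<in> carrier G"
      show "stone_cech_action G g \<in> carrier (BijGroup ?E)"
        using bij gh by (simp add: BijGroup_def)
      have "stone_cech_action G (g \<otimes> h) =
          compose ?E (stone_cech_action G g) (stone_cech_action G h)"
        using gh comp bij[of "g \<otimes> h"]
        by (intro extensionalityI[of _ ?E]) (auto simp: Bij_def compose_def)
      then show "stone_cech_action G (g \<otimes> h) =
          stone_cech_action G g \<otimes>\<^bsub>BijGroup ?E\<^esub> stone_cech_action G h"
        using bij gh by (simp add: BijGroup_def)
    qed
  qed
  have cont: "continuous_map (stone_cech (carrier G)) (stone_cech (carrier G)) (stone_cech_action G g)"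
    if g: "g \<in> carrier G" for g
    unfolding continuous_map_def topspace_stone_cech
  proof (intro conjI allI impI)
    show "stone_cech_action G g \<in> ?E \<rightarrow> ?E" using closed g by blast
    fix U assume U: "openin (stone_cech (carrier G)) U"
    show "openin (stone_cech (carrier G)) {F \<in> ?E. stone_cech_action G g F \<in> U}"
      unfolding openin_stone_cech
    proof (intro conjI ballI)
      fix F assume F: "F \<in> {F \<in> ?E. stone_cech_action G g F \<in> U}"
      then obtain A where A: "A \<subseteq> carrier G"
          "eventually (\<lambda>x. x \<in> A) (stone_cech_action G g F)"
          "{F' \<in> ?E. eventually (\<lambda>x. x \<in> A) F'} \<subseteq> U"
      proof -
        have "stone_cech_action G g F \<in> U" using F by blast
        then show ?thesis using U that unfolding openin_stone_cech by meson
      qed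
      define B where "B = {x \<in> carrier G. g \<otimes> x \<in> A}"
      have "eventually (\<lambda>x. x \<in> B) F' \<longleftrightarrow> eventually (\<lambda>x. x \<in> A) (stone_cech_action G g F')"
        if "F' \<in> ?E" for F'
        using that by (auto simp: B_def stone_cech_action_def eventually_filtermap
            ultrafilters_on_def eventually_conj_iff)
      then show "\<exists>B\<subseteq>carrier G. eventually (\<lambda>x. x \<in> B) F \<and>
          {F' \<in> ?E. eventually (\<lambda>x. x \<in> B) F'} \<subseteq> {F \<in> ?E. stone_cech_action G g F \<in> U}"
        using A F closed[OF g] by (intro exI[of _ B]) (auto simp: B_def)
    qed auto
  qed
  show ?thesis
    unfolding compact_Hausdorff_action_def compact_Hausdorff_action_axioms_def topspace_stone_cech
    using act cont compact_space_stone_cech Hausdorff_space_stone_cech by blast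
qed

end

theory Submission
  imports Defs
begin

text \<open>Write \<open>\<Gamma>\<close> for the group. Since \<open>d (g x) x = |g|\<close>, an arrow between two principal ultrafilters
  is the same thing as a pair of group elements \<open>(y, x)\<close>, with \<open>y x\<inverse>\<close> as group coordinate and with
  length \<open>d y x\<close>. A subgroupoid of \<open>\<Gamma> \<ltimes> \<beta>\<Gamma>\<close> therefore restricts to an equivalence relation on a subset
  of \<open>\<Gamma>\<close>, that is, to a disjoint family. Conversely a disjoint family \<open>\<Y>\<close> spans the subgroupoid of
  those arrows \<open>(g F, g, F)\<close> for which \<open>x\<close> and \<open>g x\<close> lie in a common member of \<open>\<Y>\<close> for
  \<open>F\<close>-almost every \<open>x\<close> (\<open>family_groupoid\<close>). Under this dictionary uniformly bounded families
  correspond to relatively compact subgroupoids: \<open>\<beta>\<Gamma>\<close> is compact and the length is proper, so both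
  conditions say that finitely many group elements occur.

  Each implication is an induction over the inductively defined class in its hypothesis. Both classes
  are closed under passing to smaller objects, and the induction statements are formulated so that
  this is built in: if \<open>\<Y>\<close> is in the decomposition class, then every open subgroupoid inside the
  groupoid of \<open>\<Y>\<close> is in the dynamical class (\<open>dynamical_class_of_decomposition_class\<close>); if \<open>H\<close> is in
  the dynamical class, then every disjoint family whose arrows all belong to \<open>H\<close> is in the
  decomposition class (\<open>decomposition_class_of_dynamical_class\<close>).

  For the first one, halves \<open>Y = Y\<^sub>0 \<union> Y\<^sub>1\<close> for a radius above \<open>r\<close> give the two basic open sets of
  ultrafilters that contain the union of all \<open>Y\<^sub>0\<close>, respectively of all \<open>Y\<^sub>1\<close>. An arrow of length at
  most \<open>r\<close> that starts in a piece stays in its neighbourhood, so the generated subgroupoid lies in the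
  groupoid of the family of neighbourhoods; it is open by \<open>open_subgroupoid_generated\<close>. For the second
  one, an open cover for the radius \<open>2 r\<close> splits each \<open>Y\<close>, and the pieces are the orbit classes of the
  generated subgroupoids. Points of one half of \<open>Y\<close> in different classes are more than \<open>2 r\<close> apart, because
  otherwise a generator would join them, and the neighbourhood of a piece stays in its class
  (\<open>separated_pieces_classes\<close>).\<close>

section \<open>Open subgroupoids of a transformation groupoid\<close>

context compact_Hausdorff_action
begin

interpretation group G
  using group_hom by (simp add: group_hom_def)

lemma mem_arrows_iff:
  "(y, g, x) \<in> arrows \<longleftrightarrow> g \<in> carrier G \<and> x \<in> topspace X \<and> y = \<phi> g x"
  by (auto simp: arrows_def)

lemma action_in_topspace: "\<lbrakk>g \<in> carrier G; x \<in> topspace X\<rbrakk> \<Longrightarrow> \<phi> g x \<in> topspace X"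
  using element_image by blast

lemma action_one: "x \<in> topspace X \<Longrightarrow> \<phi> \<one> x = x"
  using id_eq_one by (metis restrict_apply')

text \<open>As \<^term>\<open>snd\<close> is injective on arrows, the topology is that of a disjoint union of copies of the
  base space, one for each group element.\<close>

lemma openin_arrow_topology_iff:
  "openin arrow_topology S \<longleftrightarrow>
    S \<subseteq> arrows \<and> (\<forall>g\<in>carrier G. openin X {x \<in> topspace X. (\<phi> g x, g, x) \<in> S})"
proof
  assume "openin arrow_topology S"
  then obtain U where U: "openin (prod_topology (discrete_topology (carrier G)) X) U"
      "S = snd -` U \<inter> arrows"
    by (auto simp: arrow_topology_def openin_pullback_topology)
  have "openin X {x \<in> topspace X. (\<phi> g x, g, x) \<in> S}" if g: "g \<in> carrier G" for g
  proof -
    have "continuous_map X (prod_topology (discrete_topology (carrier G)) X) (\<lambda>x. (g, x))"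
      using g by (simp add: continuous_map_pairedI)
    then have "openin X {x \<in> topspace X. (g, x) \<in> U}"
      using U(1) by (rule openin_continuous_map_preimage)
    moreover have "{x \<in> topspace X. (\<phi> g x, g, x) \<in> S} = {x \<in> topspace X. (g, x) \<in> U}"
      using g by (auto simp: U(2) mem_arrows_iff)
    ultimately show ?thesis by simp
  qed
  then show "S \<subseteq> arrows \<and> (\<forall>g\<in>carrier G. openin X {x \<in> topspace X. (\<phi> g x, g, x) \<in> S})"
    using U(2) by blast
next
  assume S: "S \<subseteq> arrows \<and> (\<forall>g\<in>carrier G. openin X {x \<in> topspace X. (\<phi> g x, g, x) \<in> S})"
  let ?U = "\<Union>g\<in>carrier G. {g} \<times> {x \<in> topspace X. (\<phi> g x, g, x) \<in> S}"
  have "openin (prod_topology (discrete_topology (carrier G)) X) ?U"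
    using S by (intro openin_Union) (auto simp: openin_prod_Times_iff)
  moreover have "S = snd -` ?U \<inter> arrows"
    using S by (force simp: arrows_def)
  ultimately show "openin arrow_topology S"
    unfolding arrow_topology_def openin_pullback_topology by blast
qed

lemma topspace_arrow_topology: "topspace arrow_topology = arrows"
  by (auto simp: arrow_topology_def topspace_pullback_topology arrows_def)

lemma mem_interior_arrows_iff:
  assumes "S \<subseteq> arrows"
  shows "(y, g, x) \<in> arrow_topology interior_of S \<longleftrightarrow> g \<in> carrier G \<and> y = \<phi> g x \<and>
    (\<exists>V. openin X V \<and> x \<in> V \<and> (\<forall>v\<in>V. (\<phi> g v, g, v) \<in> S))" (is "_ \<longleftrightarrow> ?R")
proof
  assume "(y, g, x) \<in> arrow_topology interior_of S"
  then obtain T where T: "openin arrow_topology T" "(y, g, x) \<in> T" "T \<subseteq> S"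
    by (auto simp: interior_of_def)
  then have a: "g \<in> carrier G" "y = \<phi> g x" "x \<in> topspace X"
    using assms mem_arrows_iff by blast+
  then show ?R
    using T by (intro conjI exI[of _ "{v \<in> topspace X. (\<phi> g v, g, v) \<in> T}"])
      (auto simp: openin_arrow_topology_iff)
next
  assume ?R
  then obtain V where g: "g \<in> carrier G" "y = \<phi> g x" and V: "openin X V" "x \<in> V"
      "\<forall>v\<in>V. (\<phi> g v, g, v) \<in> S" by blast
  let ?T = "(\<lambda>v. (\<phi> g v, g, v)) ` V"
  have "V \<subseteq> topspace X" using V(1) by (rule openin_subset)
  then have "{v \<in> topspace X. (\<phi> h v, h, v) \<in> ?T} = (if h = g then V else {})" for h
    by auto
  then have "openin arrow_topology ?T"
    using V assms by (auto simp: openin_arrow_topology_iff)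
  then show "(y, g, x) \<in> arrow_topology interior_of S"
    unfolding interior_of_def using V g by blast
qed

lemma openin_sources:
  assumes "openin X V" "g \<in> carrier G" "openin X W"
  shows "openin X {x \<in> V. \<phi> g x \<in> W}"
proof -
  have "{x \<in> V. \<phi> g x \<in> W} = V \<inter> {x \<in> topspace X. \<phi> g x \<in> W}"
    using openin_subset[OF assms(1)] by auto
  then show ?thesis
    using assms openin_continuous_map_preimage[OF continuous] by (simp add: openin_Int)
qed

lemma
  assumes "subgroupoid H"
  shows subgroupoid_subset_arrows: "H \<subseteq> arrows"
    and subgroupoid_mult: "\<lbrakk>(z, h, y) \<in> H; (y, g, x) \<in> H\<rbrakk> \<Longrightarrow> (z, h \<otimes> g, x) \<in> H"
    and subgroupoid_inv: "(y, g, x) \<in> H \<Longrightarrow> (x, inv g, y) \<in> H"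
    and subgroupoid_source: "(y, g, x) \<in> H \<Longrightarrow> (x, \<one>, x) \<in> H"
    and subgroupoid_target: "(y, g, x) \<in> H \<Longrightarrow> (y, \<one>, y) \<in> H"
  using assms unfolding subgroupoid_def by blast+

text \<open>By continuity of the action, a small move of the source of a product of two arrows moves both
  factors only slightly, so they stay in the subgroupoid if they are interior to it; the same goes for
  inverses and units.\<close>

lemma subgroupoid_interior_of:
  assumes H: "subgroupoid H"
  shows "subgroupoid (arrow_topology interior_of H)"
proof -
  note sub = subgroupoid_subset_arrows[OF H] and mult = subgroupoid_mult[OF H]
    and inv = subgroupoid_inv[OF H]
  note iff = mem_interior_arrows_iff[OF sub]
  have invact: "\<phi> (inv g) (\<phi> g x) = x" if "g \<in> carrier G" "x \<in> topspace X" for g x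
    using orbit_sym_aux that by blast
  have invact': "\<phi> g (\<phi> (inv g) x) = x" if "g \<in> carrier G" "x \<in> topspace X" for g x
    using invact[OF inv_closed[OF that(1)] that(2)] that(1) by simp
  have P: "(z, h \<otimes> g, x) \<in> arrow_topology interior_of H"
    if hy: "(z, h, y) \<in> arrow_topology interior_of H" and gx: "(y, g, x) \<in> arrow_topology interior_of H"
    for z h y g x
  proof -
    from hy obtain W where h: "h \<in> carrier G" "z = \<phi> h y"
      and W: "openin X W" "y \<in> W" "\<forall>v\<in>W. (\<phi> h v, h, v) \<in> H" unfolding iff by blast
    from gx obtain V where g: "g \<in> carrier G" "y = \<phi> g x"
      and V: "openin X V" "x \<in> V" "\<forall>v\<in>V. (\<phi> g v, g, v) \<in> H" unfolding iff by blast
    have "v \<in> topspace X" if "v \<in> V" for v using V(1) that openin_subset by blast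
    then have comp: "\<phi> (h \<otimes> g) v = \<phi> h (\<phi> g v)" if "v \<in> V" for v
      using composition_rule that h g by blast
    show ?thesis
      unfolding iff
    proof (intro conjI exI)
      show "openin X {v \<in> V. \<phi> g v \<in> W}" using openin_sources V W g by blast
      show "\<forall>v\<in>{v \<in> V. \<phi> g v \<in> W}. (\<phi> (h \<otimes> g) v, h \<otimes> g, v) \<in> H"
        using mult V(3) W(3) comp by fastforce
    qed (use h g V(2) W(2) comp[OF V(2)] in simp_all)
  qed
  have I: "(x, inv g, y) \<in> arrow_topology interior_of H"
    and U1: "(x, \<one>, x) \<in> arrow_topology interior_of H"
    and U2: "(y, \<one>, y) \<in> arrow_topology interior_of H"
    if gx: "(y, g, x) \<in> arrow_topology interior_of H" for y g x
  proof -
    from gx obtain V where g: "g \<in> carrier G" "y = \<phi> g x"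
      and V: "openin X V" "x \<in> V" "\<forall>v\<in>V. (\<phi> g v, g, v) \<in> H" unfolding iff by blast
    have Vsub: "v \<in> topspace X" if "v \<in> V" for v using V(1) that openin_subset by blast
    let ?W = "{w \<in> topspace X. \<phi> (inv g) w \<in> V}"
    have x: "x \<in> topspace X" using Vsub V(2) .
    have "openin X ?W" using openin_sources[OF openin_topspace inv_closed[OF g(1)] V(1)] .
    moreover have "y \<in> ?W" using V(2) invact[OF g(1) x] action_in_topspace[OF g(1) x] g(2) by simp
    ultimately have W: "openin X ?W" "y \<in> ?W" .
    have xy: "x = \<phi> (inv g) y" using invact[OF g(1) x] g(2) by simp
    have arr: "(w, g, \<phi> (inv g) w) \<in> H" if "w \<in> ?W" for w
      using V(3) that invact'[OF g(1), of w] by fastforce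
    show "(x, inv g, y) \<in> arrow_topology interior_of H"
      unfolding iff
    proof (intro conjI exI[of _ ?W] ballI)
      fix w assume "w \<in> ?W"
      then show "(\<phi> (inv g) w, inv g, w) \<in> H" using inv arr by blast
    qed (fact inv_closed[OF g(1)] xy W)+
    show "(x, \<one>, x) \<in> arrow_topology interior_of H"
      unfolding iff
    proof (intro conjI exI[of _ V] ballI)
      fix v assume "v \<in> V"
      then show "(\<phi> \<one> v, \<one>, v) \<in> H"
        using subgroupoid_source[OF H] V(3) action_one[OF Vsub] by fastforce
    qed (use V action_one[OF x] in simp_all)
    show "(y, \<one>, y) \<in> arrow_topology interior_of H"
      unfolding iff
    proof (intro conjI exI[of _ ?W] ballI)
      fix w assume w: "w \<in> ?W"
      then show "(\<phi> \<one> w, \<one>, w) \<in> H" using subgroupoid_target[OF H arr[OF w]] action_one by simp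
    qed (use W action_one[of y] in simp_all)
  qed
  have "arrow_topology interior_of H \<subseteq> arrows"
    using interior_of_subset sub by (rule order_trans)
  then show ?thesis
    using P I U1 U2 by (simp add: subgroupoid_def) blast
qed

lemma subgroupoid_generated:
  assumes "subgroupoid H" "S \<subseteq> H"
  shows "subgroupoid (generated_subgroupoid S)"
  unfolding subgroupoid_def
proof (intro conjI allI impI)
  have gen: "a \<in> generated_subgroupoid S \<longleftrightarrow> (\<forall>K. subgroupoid K \<longrightarrow> S \<subseteq> K \<longrightarrow> a \<in> K)" for a
    unfolding generated_subgroupoid_def by blast
  show "generated_subgroupoid S \<subseteq> arrows"
    using gen assms subgroupoid_subset_arrows by blast
  show "(z, h \<otimes> g, x) \<in> generated_subgroupoid S"
    if "(z, h, y) \<in> generated_subgroupoid S \<and> (y, g, x) \<in> generated_subgroupoid S" for z h y g x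
    using that unfolding gen by (meson subgroupoid_mult)
  fix y g x assume "(y, g, x) \<in> generated_subgroupoid S"
  then show "(x, inv g, y) \<in> generated_subgroupoid S"
      "(x, \<one>, x) \<in> generated_subgroupoid S" "(y, \<one>, y) \<in> generated_subgroupoid S"
    unfolding gen by (meson subgroupoid_inv subgroupoid_source subgroupoid_target)+
qed

lemma generated_subgroupoid_subset:
  "\<lbrakk>subgroupoid H; S \<subseteq> H\<rbrakk> \<Longrightarrow> generated_subgroupoid S \<subseteq> H"
  unfolding generated_subgroupoid_def by blast

lemma subset_generated_subgroupoid: "S \<subseteq> generated_subgroupoid S"
  unfolding generated_subgroupoid_def by blast

text \<open>The interior of the generated subgroupoid is a subgroupoid which contains the open set of
  generators, hence it contains everything that they generate.\<close>

lemma open_subgroupoid_generated: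
  assumes H: "subgroupoid H" and S: "S \<subseteq> H" "openin arrow_topology S"
  shows "open_subgroupoid (generated_subgroupoid S)"
proof -
  let ?K = "generated_subgroupoid S"
  have K: "subgroupoid ?K" using subgroupoid_generated H S(1) .
  have "?K \<subseteq> arrow_topology interior_of ?K"
    using S(2) subset_generated_subgroupoid
    by (intro generated_subgroupoid_subset subgroupoid_interior_of K interior_of_maximal)
  then have "openin arrow_topology ?K"
    by (metis interior_of_subset openin_interior_of subset_antisym)
  with K show ?thesis by (simp add: open_subgroupoid_def)
qed

lemma openin_units:
  assumes "open_subgroupoid H"
  shows "openin X (units_of_subgroupoid H)"
proof -
  have "openin X {x \<in> topspace X. (\<phi> \<one> x, \<one>, x) \<in> H}"
    using assms by (simp add: open_subgroupoid_def openin_arrow_topology_iff)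
  moreover have "{x \<in> topspace X. (\<phi> \<one> x, \<one>, x) \<in> H} = units_of_subgroupoid H"
  proof -
    have "H \<subseteq> arrows" using assms by (simp add: open_subgroupoid_def subgroupoid_def)
    then have "x \<in> topspace X" if "(x, \<one>, x) \<in> H" for x
      using that mem_arrows_iff by blast
    then show ?thesis
      by (auto simp: units_of_subgroupoid_def action_one)
  qed
  ultimately show ?thesis by simp
qed

lemma openin_arrows_source:
  assumes H: "openin arrow_topology H" and U: "openin X U"
  shows "openin arrow_topology {(y, g, x) \<in> H. x \<in> U \<and> P g}"
proof -
  have "{x \<in> topspace X. (\<phi> g x, g, x) \<in> {(y, g, x) \<in> H. x \<in> U \<and> P g}} =
      (if P g then U \<inter> {x \<in> topspace X. (\<phi> g x, g, x) \<in> H} else {})" for g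
    using openin_subset[OF U] by auto
  then show ?thesis
    using H U by (auto simp: openin_arrow_topology_iff openin_Int)
qed

text \<open>The arrows with a fixed group coordinate form an open and closed copy of the compact base
  space.\<close>

lemma relatively_compact_iff_finite:
  assumes "H \<subseteq> arrows"
  shows "relatively_compact H \<longleftrightarrow> finite ((\<lambda>(y, g, x). g) ` H)"
proof
  assume "relatively_compact H"
  then have comp: "compactin arrow_topology (arrow_topology closure_of H)"
    by (simp add: relatively_compact_def)
  define E where "E g = {(y, g', x) \<in> arrows. x \<in> topspace X \<and> g' = g}" for g
  have "openin arrow_topology (E g)" for g
    using openin_arrows_source[OF openin_topspace openin_topspace, of "\<lambda>g'. g' = g"]
    by (simp add: topspace_arrow_topology E_def)
  then have "\<forall>T\<in>range E. openin arrow_topology T" by blast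
  moreover have "arrow_topology closure_of H \<subseteq> \<Union>(range E)"
    using closure_of_subset_topspace[of arrow_topology H]
    by (auto simp: topspace_arrow_topology E_def mem_arrows_iff)
  ultimately obtain \<F> where \<F>: "finite \<F>" "\<F> \<subseteq> range E"
      "arrow_topology closure_of H \<subseteq> \<Union>\<F>"
    using comp unfolding compactin_def by meson
  then obtain N where N: "finite N" "\<F> = E ` N"
    using finite_subset_image by metis
  have "H \<subseteq> arrow_topology closure_of H"
    using assms by (simp add: closure_of_subset topspace_arrow_topology)
  then have "(\<lambda>(y, g, x). g) ` H \<subseteq> N" using \<F>(3) N(2) by (fastforce simp: E_def)
  then show "finite ((\<lambda>(y, g, x). g) ` H)" using N(1) finite_subset by blast
next
  define N where "N = (\<lambda>(y, g, x). g) ` H"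
  assume "finite ((\<lambda>(y, g, x). g) ` H)"
  then have N: "finite N" "N \<subseteq> carrier G" using assms by (auto simp: N_def arrows_def)
  let ?C = "\<Union>g\<in>N. (\<lambda>x. (\<phi> g x, g, x)) ` topspace X"
  have cont: "continuous_map X arrow_topology (\<lambda>x. (\<phi> g x, g, x))" if "g \<in> N" for g
    unfolding continuous_map_def topspace_arrow_topology
  proof (intro conjI allI impI)
    show "(\<lambda>x. (\<phi> g x, g, x)) \<in> topspace X \<rightarrow> arrows" using that N by (auto simp: mem_arrows_iff)
  qed (use that N in \<open>auto simp: openin_arrow_topology_iff\<close>)
  have "compactin arrow_topology ?C"
    using N(1) cont compact by (intro compactin_Union) (auto simp: compact_space_def intro: image_compactin)
  moreover have "closedin arrow_topology ?C"
  proof -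
    have eq: "arrows - ?C = {(y, g, x) \<in> arrows. x \<in> topspace X \<and> g \<notin> N}"
      by (auto simp: mem_arrows_iff)
    have "openin arrow_topology (arrows - ?C)"
      unfolding eq using openin_arrows_source[OF openin_topspace openin_topspace, of "\<lambda>g. g \<notin> N"]
      by (simp add: topspace_arrow_topology)
    moreover have "?C \<subseteq> arrows" using N(2) by (auto simp: mem_arrows_iff)
    ultimately show ?thesis by (simp add: closedin_def topspace_arrow_topology)
  qed
  moreover have "H \<subseteq> ?C"
    using assms by (fastforce simp: N_def mem_arrows_iff)
  ultimately show "relatively_compact H"
    unfolding relatively_compact_def
    by (meson closed_compactin closedin_closure_of closure_of_minimal)
qed

lemma subgroupoid_arrows: "subgroupoid arrows"
  unfolding subgroupoid_def
proof (intro conjI allI impI)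
  fix z h y g x assume "(z, h, y) \<in> arrows \<and> (y, g, x) \<in> arrows"
  then show "(z, h \<otimes> g, x) \<in> arrows"
    by (simp add: mem_arrows_iff composition_rule)
next
  fix y g x assume a: "(y, g, x) \<in> arrows"
  then show "(x, inv g, y) \<in> arrows"
    using orbit_sym_aux by (fastforce simp: mem_arrows_iff action_in_topspace)
  show "(x, \<one>, x) \<in> arrows" "(y, \<one>, y) \<in> arrows"
    using a by (simp_all add: mem_arrows_iff action_in_topspace action_one)
qed simp

lemma open_subgroupoid_arrows: "open_subgroupoid arrows"
  using subgroupoid_arrows openin_topspace[of arrow_topology]
  by (simp add: open_subgroupoid_def topspace_arrow_topology)

end


section \<open>Disjoint families\<close>

lemma (in Metric_space) uniformly_bounded_iff:
  "uniformly_bounded \<Y> \<longleftrightarrow> (\<exists>R::nat. \<forall>Y\<in>\<Y>. \<forall>x\<in>Y. \<forall>y\<in>Y. d x y \<le> real R)" (is "_ \<longleftrightarrow> ?R")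
proof
  assume "uniformly_bounded \<Y>"
  then obtain R :: nat where "(SUP Y\<in>\<Y>. mdiam Y) < ereal (real R)"
    unfolding uniformly_bounded_def by (metis less_PInf_Ex_of_nat order_less_irrefl)
  then have le: "(SUP Y\<in>\<Y>. SUP x\<in>Y. SUP y\<in>Y. ereal (d x y)) \<le> ereal (real R)"
    by (simp add: mdiam_def)
  have "ereal (d x y) \<le> ereal (real R)" if "Y \<in> \<Y>" "x \<in> Y" "y \<in> Y" for Y x y
    using le that by (auto simp: SUP_le_iff)
  then show ?R by (intro exI[of _ R]) auto
next
  assume ?R
  then obtain R :: nat where R: "\<forall>Y\<in>\<Y>. \<forall>x\<in>Y. \<forall>y\<in>Y. d x y \<le> real R" by blast
  then have "(SUP Y\<in>\<Y>. mdiam Y) \<le> ereal (real R)"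
    unfolding mdiam_def by (auto intro!: SUP_least)
  then show "uniformly_bounded \<Y>"
    unfolding uniformly_bounded_def by (rule order.strict_trans1) simp
qed


lemma (in Metric_space) disjoint_subspaces_mem:
  "\<lbrakk>disjoint_subspaces \<Y>; Y \<in> \<Y>; x \<in> Y\<rbrakk> \<Longrightarrow> x \<in> M"
  by (auto simp: disjoint_subspaces_def)

lemma (in Metric_space) disjoint_subspaces_unique:
  "\<lbrakk>disjoint_subspaces \<Y>; Y \<in> \<Y>; Y' \<in> \<Y>; x \<in> Y; x \<in> Y'\<rbrakk> \<Longrightarrow> Y = Y'"
  unfolding disjoint_subspaces_def disjoint_def by blast

sublocale proper_length_function \<subseteq> word: Metric_space "carrier G" "length_dist G len"
  by (rule Metric_space_length_dist)

sublocale proper_length_function \<subseteq>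
    beta: compact_Hausdorff_action G "stone_cech (carrier G)" "stone_cech_action G"
  by (rule compact_Hausdorff_action_stone_cech)

context proper_length_function
begin

lemma length_dist_eq:
  "\<lbrakk>x \<in> carrier G; y \<in> carrier G\<rbrakk> \<Longrightarrow> length_dist G len x y = real (len (x \<otimes> inv y))"
  by (simp add: length_dist_def)

lemma length_dist_translate:
  "\<lbrakk>g \<in> carrier G; x \<in> carrier G\<rbrakk> \<Longrightarrow> length_dist G len (g \<otimes> x) x = real (len g)"
  by (simp add: length_dist_eq m_assoc)

text \<open>The word metric takes integer values, so pairwise distances above a bound stay above it in the
  infimum.\<close>

lemma less_set_mdist:
  assumes "A \<subseteq> carrier G" "B \<subseteq> carrier G"
    and far: "\<And>x y. \<lbrakk>x \<in> A; y \<in> B\<rbrakk> \<Longrightarrow> s < length_dist G len x y"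
  shows "ereal s < word.set_mdist A B"
proof -
  have "ereal (of_int (\<lfloor>s\<rfloor> + 1)) \<le> word.set_mdist A B"
    unfolding word.set_mdist_def
  proof (intro INF_greatest)
    fix x y assume xy: "x \<in> A" "y \<in> B"
    then have eq: "length_dist G len x y = real (len (x \<otimes> inv y))"
      using assms(1,2) by (intro length_dist_eq) auto
    have "s < real_of_int (int (len (x \<otimes> inv y)))"
      using far[OF xy] by (simp add: eq)
    then have "\<lfloor>s\<rfloor> < int (len (x \<otimes> inv y))"
      by (simp only: floor_less_iff)
    then have "\<lfloor>s\<rfloor> + 1 \<le> int (len (x \<otimes> inv y))" by simp
    then show "ereal (of_int (\<lfloor>s\<rfloor> + 1)) \<le> ereal (length_dist G len x y)"
      unfolding eq ereal_less_eq(3) by (metis of_int_le_iff of_int_of_nat_eq)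
  qed
  moreover have "ereal s < ereal (of_int (\<lfloor>s\<rfloor> + 1))"
    by simp
  ultimately show ?thesis by (rule order.strict_trans2[rotated])
qed

text \<open>The pieces of \<open>Y \<inter> A\<close> are its traces on the classes of \<open>E\<close>. Enlarging a piece by \<open>r\<close> inside
  \<open>Y\<close> does not leave its class, so the enlarged pieces are again disjoint; they form \<open>\<Z>\<close>.\<close>

lemma separated_pieces_classes:
  assumes \<Y>: "word.disjoint_subspaces \<Y>" and r: "0 \<le> r" and E: "sym E" "trans E"
    and near: "\<And>Y x y. \<lbrakk>Y \<in> \<Y>; x \<in> Y \<inter> A; y \<in> Y; length_dist G len x y \<le> 2 * r\<rbrakk> \<Longrightarrow> (x, y) \<in> E"
  shows "\<exists>\<Z>. word.disjoint_subspaces \<Z> \<and> (\<forall>Z\<in>\<Z>. Z \<times> Z \<subseteq> E) \<and>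
    (\<forall>Y\<in>\<Y>. word.separated_pieces r \<Y> \<Z> (Y \<inter> A))"
proof -
  define piece where "piece Y x = {z \<in> Y \<inter> A. (x, z) \<in> E}" for Y x
  define N where "N Y x = word.family_nbhd r \<Y> (piece Y x)" for Y x
  define \<Z> where "\<Z> = {N Y x | Y x. Y \<in> \<Y> \<and> x \<in> Y \<inter> A}"
  have carrier: "Y \<subseteq> carrier G" if "Y \<in> \<Y>" for Y
    using word.disjoint_subspaces_mem[OF \<Y>] that by blast
  have unique: "Y = Y'" if "Y \<in> \<Y>" "Y' \<in> \<Y>" "x \<in> Y" "x \<in> Y'" for Y Y' x
    using word.disjoint_subspaces_unique[OF \<Y>] that by blast
  have symE: "(y, x) \<in> E" if "(x, y) \<in> E" for x y using E(1) that by (rule symD)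
  have transE: "(x, z) \<in> E" if "(x, y) \<in> E" "(y, z) \<in> E" for x y z using E(2) that by (rule transD)
  have refl: "(x, x) \<in> E" if "Y \<in> \<Y>" "x \<in> Y \<inter> A" for Y x
  proof -
    have "length_dist G len x x = 0"
      using carrier that by (intro word.zero[THEN iffD2]) auto
    then show ?thesis using near[OF that] that r by simp
  qed
  have ND: "y \<in> Y \<and> (x, y) \<in> E" if Y: "Y \<in> \<Y>" and y: "y \<in> N Y x" for Y x y
  proof -
    from y obtain z where z: "z \<in> piece Y x" and d: "word.family_dist \<Y> y z < ereal r"
      by (auto simp: N_def word.family_nbhd_def)
    have "\<exists>Y'\<in>\<Y>. y \<in> Y' \<and> z \<in> Y'"
      using d by (auto simp: word.family_dist_def split: if_splits)
    moreover have "length_dist G len y z < r"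
      using d by (auto simp: word.family_dist_def split: if_splits)
    ultimately obtain Y' where Y': "Y' \<in> \<Y>" "y \<in> Y'" "z \<in> Y'" "length_dist G len y z < r" by blast
    have zY: "z \<in> Y \<inter> A" "(x, z) \<in> E" using z by (auto simp: piece_def)
    have "Y' = Y" using unique Y Y' zY by blast
    then have "(z, y) \<in> E"
      using near[OF Y zY(1), of y] Y' r word.commute[of y z] by simp
    then show ?thesis using transE zY Y' \<open>Y' = Y\<close> by blast
  qed
  have "word.disjoint_subspaces \<Z>"
    unfolding word.disjoint_subspaces_def
  proof
    show "\<Z> \<subseteq> Pow (carrier G)" using ND carrier by (fastforce simp: \<Z>_def)
    show "disjoint \<Z>"
    proof (rule disjointI, rule ccontr)
      fix Z Z' assume Z: "Z \<in> \<Z>" "Z' \<in> \<Z>" "Z \<noteq> Z'" and "Z \<inter> Z' \<noteq> {}"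
      then obtain y where y: "y \<in> Z" "y \<in> Z'" by blast
      obtain Y x where Y: "Z = N Y x" "Y \<in> \<Y>" using Z by (auto simp: \<Z>_def)
      obtain Y' x' where Y': "Z' = N Y' x'" "Y' \<in> \<Y>" using Z by (auto simp: \<Z>_def)
      have "y \<in> Y" "(x, y) \<in> E" "y \<in> Y'" "(x', y) \<in> E" using ND Y Y' y by blast+
      then have "Y = Y'" "(x, x') \<in> E" using unique Y Y' transE symE by blast+
      moreover have "(x, z) \<in> E \<longleftrightarrow> (x', z) \<in> E" for z
        using \<open>(x, x') \<in> E\<close> transE symE by blast
      ultimately have "piece Y x = piece Y' x'" by (simp add: piece_def)
      then show False using Z(3) Y(1) Y'(1) by (simp add: N_def)
    qed
  qed
  moreover have "Z \<times> Z \<subseteq> E" if Z: "Z \<in> \<Z>" for Z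
  proof -
    obtain Y x where "Z = N Y x" "Y \<in> \<Y>" using Z by (auto simp: \<Z>_def)
    then have "(x, y) \<in> E" if "y \<in> Z" for y using ND that by blast
    then show ?thesis using transE symE by blast
  qed
  moreover have "word.separated_pieces r \<Y> \<Z> (Y \<inter> A)" if Y: "Y \<in> \<Y>" for Y
    unfolding word.separated_pieces_def
  proof (intro exI[of _ "piece Y ` (Y \<inter> A)"] conjI ballI impI)
    show "Y \<inter> A = \<Union>(piece Y ` (Y \<inter> A))"
      using refl[OF Y] by (auto simp: piece_def)
    have eq: "piece Y x = piece Y x'" if "(x, x') \<in> E" for x x'
    proof -
      have "(x, z) \<in> E \<longleftrightarrow> (x', z) \<in> E" for z using that transE symE by blast
      then show ?thesis by (simp add: piece_def)
    qed
    show "disjoint (piece Y ` (Y \<inter> A))"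
    proof (rule disjointI, rule ccontr)
      fix P Q assume "P \<in> piece Y ` (Y \<inter> A)" "Q \<in> piece Y ` (Y \<inter> A)" "P \<noteq> Q" "P \<inter> Q \<noteq> {}"
      then obtain x x' z where "P = piece Y x" "Q = piece Y x'" "P \<noteq> Q" "(x, z) \<in> E" "(x', z) \<in> E"
        by (auto simp: piece_def)
      then show False using eq transE symE by blast
    qed
    fix P assume P: "P \<in> piece Y ` (Y \<inter> A)"
    then show "word.family_nbhd r \<Y> P \<in> \<Z>" using Y by (auto simp: \<Z>_def N_def)
    fix Q assume Q: "Q \<in> piece Y ` (Y \<inter> A)" and "P \<noteq> Q"
    obtain x x' where x: "P = piece Y x" "Q = piece Y x'" using P Q by blast
    show "ereal (2 * r) < word.set_mdist P Q"
    proof (rule less_set_mdist)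
      show "P \<subseteq> carrier G" "Q \<subseteq> carrier G" using x carrier[OF Y] by (auto simp: piece_def)
      fix u v assume uv: "u \<in> P" "v \<in> Q"
      show "2 * r < length_dist G len u v"
      proof (rule ccontr)
        assume "\<not> 2 * r < length_dist G len u v"
        then have "(u, v) \<in> E" using near[OF Y, of u v] uv x by (auto simp: piece_def)
        moreover have "(x, u) \<in> E" "(x', v) \<in> E" using uv x by (auto simp: piece_def)
        ultimately have "(x, x') \<in> E" using transE symE by blast
        then show False using eq x \<open>P \<noteq> Q\<close> by blast
      qed
    qed
  qed
  ultimately show ?thesis by blast
qed


section \<open>From groupoids to families\<close>

text \<open>The arrow over the dense orbit \<open>\<Gamma> \<subseteq> \<beta>\<Gamma>\<close> from \<open>x\<close> to \<open>y\<close>; the action on this orbit is free, so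
  there is exactly one.\<close>

definition orbit_arrow :: "'a \<Rightarrow> 'a \<Rightarrow> 'a filter \<times> 'a \<times> 'a filter" where
  "orbit_arrow y x = (principal {y}, y \<otimes> inv x, principal {x})"

lemma orbit_arrow_in_arrows:
  "\<lbrakk>x \<in> carrier G; y \<in> carrier G\<rbrakk> \<Longrightarrow> orbit_arrow y x \<in> beta.arrows"
  by (simp add: orbit_arrow_def beta.mem_arrows_iff topspace_stone_cech
      principal_in_ultrafilters_on stone_cech_action_principal m_assoc)

lemma orbit_equivalence:
  assumes K: "beta.subgroupoid K"
  defines "E \<equiv> {(x, y). x \<in> carrier G \<and> y \<in> carrier G \<and> orbit_arrow y x \<in> K}"
  shows "sym E" "trans E"
proof -
  show "sym E"
  proof (rule symI)
    fix x y assume "(x, y) \<in> E"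
    then have xy: "x \<in> carrier G" "y \<in> carrier G" "orbit_arrow y x \<in> K" by (auto simp: E_def)
    then have "(principal {x}, inv (y \<otimes> inv x), principal {y}) \<in> K"
      using beta.subgroupoid_inv[OF K] by (simp add: orbit_arrow_def)
    then show "(y, x) \<in> E" using xy by (simp add: E_def orbit_arrow_def inv_mult_group)
  qed
  show "trans E"
  proof (rule transI)
    fix x y z assume "(x, y) \<in> E" "(y, z) \<in> E"
    then have xyz: "x \<in> carrier G" "y \<in> carrier G" "z \<in> carrier G"
      and K': "orbit_arrow y x \<in> K" "orbit_arrow z y \<in> K" by (auto simp: E_def)
    have "(principal {z}, (z \<otimes> inv y) \<otimes> (y \<otimes> inv x), principal {x}) \<in> K"
      using beta.subgroupoid_mult[OF K] K' by (simp add: orbit_arrow_def)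
    moreover have "(z \<otimes> inv y) \<otimes> (y \<otimes> inv x) = z \<otimes> inv x"
      using xyz by (metis inv_closed inv_solve_left m_assoc m_closed)
    ultimately show "(x, z) \<in> E" using xyz by (simp add: E_def orbit_arrow_def)
  qed
qed

text \<open>The family is only required to have its arrows in \<open>H\<close>, not to consist of the full orbit classes
  of \<open>H\<close>: the neighbourhoods of the pieces, to which the induction hypothesis is applied, can be
  proper subsets of the classes.\<close>

lemma decomposition_class_of_dynamical_class:
  assumes "H \<in> beta.dynamical_class len" "word.disjoint_subspaces \<Y>"
    and "\<And>Y x y. \<lbrakk>Y \<in> \<Y>; x \<in> Y; y \<in> Y\<rbrakk> \<Longrightarrow> orbit_arrow y x \<in> H"
  shows "\<Y> \<in> word.decomposition_class"
  using assms
proof (induction arbitrary: \<Y> rule: beta.dynamical_class.induct)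
  case (relatively_compact H)
  have "H \<subseteq> beta.arrows"
    using relatively_compact.hyps(1) by (simp add: beta.open_subgroupoid_def beta.subgroupoid_def)
  then have fin: "finite ((\<lambda>(y, g, x). g) ` H)"
    using relatively_compact.hyps(2) beta.relatively_compact_iff_finite by blast
  have "length_dist G len y x \<le> real (Max (len ` (\<lambda>(y, g, x). g) ` H))"
    if "Y \<in> \<Y>" "y \<in> Y" "x \<in> Y" for Y x y
  proof -
    have "y \<otimes> inv x \<in> (\<lambda>(y, g, x). g) ` H"
      using relatively_compact.prems(2)[of Y x y] that by (force simp: orbit_arrow_def)
    then have "len (y \<otimes> inv x) \<le> Max (len ` (\<lambda>(y, g, x). g) ` H)"
      using fin by (intro Max_ge) auto
    then show ?thesis by (simp add: length_dist_def)
  qed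
  then have "word.uniformly_bounded \<Y>"
    unfolding word.uniformly_bounded_iff by blast
  then show ?case using relatively_compact.prems(1) word.decomposition_class.bounded by blast
next
  case (decomposable H)
  note \<Y> = decomposable.prems(1) and in_H = decomposable.prems(2)
  have carrier: "x \<in> carrier G" if "Y \<in> \<Y>" "x \<in> Y" for Y x
    using word.disjoint_subspaces_mem[OF \<Y>] that by blast
  have H: "beta.subgroupoid H" using decomposable.hyps(1) by (simp add: beta.open_subgroupoid_def)
  have "word.decomposable_over word.decomposition_class \<Y>"
    unfolding word.decomposable_over_def
  proof (intro allI impI)
    fix r :: real assume r: "0 \<le> r"
    \<comment> \<open>The radius \<open>2 r\<close> is the separation required of the pieces; it is at least the \<open>r\<close> needed
      for the neighbourhoods.\<close>
    define gens where "gens U = {(y, g, x) \<in> H. x \<in> U \<and> real (len g) \<le> 2 * r}" for U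
    define tr where "tr U = {x. principal {x} \<in> U}" for U :: "'a filter set"
    obtain U0 U1 where U: "beta.units_of_subgroupoid H = U0 \<union> U1"
      and gen: "\<And>U. U \<in> {U0, U1} \<Longrightarrow> beta.generated_subgroupoid (gens U) \<in>
        beta.dynamical_class len \<inter> {H. \<forall>\<Y>. word.disjoint_subspaces \<Y> \<longrightarrow>
          (\<forall>Y x y. Y \<in> \<Y> \<longrightarrow> x \<in> Y \<longrightarrow> y \<in> Y \<longrightarrow> orbit_arrow y x \<in> H) \<longrightarrow>
          \<Y> \<in> word.decomposition_class}"
      using decomposable.IH[unfolded beta.decomposable_over_def, rule_format, of "2 * r"] r
      unfolding gens_def by fastforce
    have "\<exists>\<Z>\<in>word.decomposition_class. \<forall>Y\<in>\<Y>. word.separated_pieces r \<Y> \<Z> (Y \<inter> tr U)"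
      if "U \<in> {U0, U1}" for U
    proof -
      let ?K = "beta.generated_subgroupoid (gens U)"
      have K: "beta.subgroupoid ?K"
        by (rule beta.subgroupoid_generated[OF H]) (auto simp: gens_def)
      define E where "E = {(x, y). x \<in> carrier G \<and> y \<in> carrier G \<and> orbit_arrow y x \<in> ?K}"
      have near: "(x, y) \<in> E"
        if "Y \<in> \<Y>" "x \<in> Y \<inter> tr U" "y \<in> Y" "length_dist G len x y \<le> 2 * r" for Y x y
      proof -
        have xy: "x \<in> carrier G" "y \<in> carrier G" using carrier that by blast+
        then have "real (len (y \<otimes> inv x)) \<le> 2 * r"
          using that(4) word.commute[of x y] length_dist_eq by simp
        then have "orbit_arrow y x \<in> gens U"
          using in_H[of Y x y] that by (simp add: gens_def orbit_arrow_def tr_def)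
        then show ?thesis
          using xy beta.subset_generated_subgroupoid by (auto simp: E_def)
      qed
      have "\<exists>\<Z>. word.disjoint_subspaces \<Z> \<and> (\<forall>Z\<in>\<Z>. Z \<times> Z \<subseteq> E) \<and>
          (\<forall>Y\<in>\<Y>. word.separated_pieces r \<Y> \<Z> (Y \<inter> tr U))"
        by (rule separated_pieces_classes[OF \<Y> r orbit_equivalence[OF K, folded E_def]])
          (erule (3) near)
      then obtain \<Z> where \<Z>: "word.disjoint_subspaces \<Z>" "\<forall>Z\<in>\<Z>. Z \<times> Z \<subseteq> E"
          "\<forall>Y\<in>\<Y>. word.separated_pieces r \<Y> \<Z> (Y \<inter> tr U)" by blast
      have "\<forall>Z x y. Z \<in> \<Z> \<longrightarrow> x \<in> Z \<longrightarrow> y \<in> Z \<longrightarrow> orbit_arrow y x \<in> ?K"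
        using \<Z>(2) unfolding E_def by blast
      then have "\<Z> \<in> word.decomposition_class" using gen[OF that] \<Z>(1) by blast
      then show ?thesis using \<Z>(3) by blast
    qed
    note pieces = this
    obtain \<Z>0 where \<Z>0: "\<Z>0 \<in> word.decomposition_class"
        "\<forall>Y\<in>\<Y>. word.separated_pieces r \<Y> \<Z>0 (Y \<inter> tr U0)"
      using pieces[of U0] by blast
    obtain \<Z>1 where \<Z>1: "\<Z>1 \<in> word.decomposition_class"
        "\<forall>Y\<in>\<Y>. word.separated_pieces r \<Y> \<Z>1 (Y \<inter> tr U1)"
      using pieces[of U1] by blast
    have cover: "Y = (Y \<inter> tr U0) \<union> (Y \<inter> tr U1)" if Y: "Y \<in> \<Y>" for Y
    proof -
      have "x \<in> tr U0 \<union> tr U1" if "x \<in> Y" for x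
      proof -
        have "principal {x} \<in> beta.units_of_subgroupoid H"
          using in_H[OF Y that that] carrier[OF Y that]
          by (simp add: orbit_arrow_def beta.units_of_subgroupoid_def)
        then show ?thesis by (simp add: U tr_def)
      qed
      then show ?thesis by blast
    qed
    show "\<exists>\<Z>0\<in>word.decomposition_class. \<exists>\<Z>1\<in>word.decomposition_class. \<forall>Y\<in>\<Y>. \<exists>Y0 Y1.
        Y = Y0 \<union> Y1 \<and> word.separated_pieces r \<Y> \<Z>0 Y0 \<and> word.separated_pieces r \<Y> \<Z>1 Y1"
    proof (intro bexI ballI exI conjI)
      fix Y assume Y: "Y \<in> \<Y>"
      show "Y = (Y \<inter> tr U0) \<union> (Y \<inter> tr U1)" using cover[OF Y] .
      show "word.separated_pieces r \<Y> \<Z>0 (Y \<inter> tr U0)" using \<Z>0(2) Y by blast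
      show "word.separated_pieces r \<Y> \<Z>1 (Y \<inter> tr U1)" using \<Z>1(2) Y by blast
    qed (fact \<Z>0(1) \<Z>1(1))+
  qed
  then show ?case using \<Y> by (rule word.decomposition_class.decomposable[rotated])
qed


section \<open>From families to groupoids\<close>

definition family_groupoid :: "'a set set \<Rightarrow> ('a filter \<times> 'a \<times> 'a filter) set" where
  "family_groupoid \<Y> = {(y, g, F) \<in> beta.arrows.
    eventually (\<lambda>x. \<exists>Y\<in>\<Y>. x \<in> Y \<and> g \<otimes> x \<in> Y) F}"

text \<open>The last equation moves a statement about the target of an arrow to its source, where the
  defining conditions of two composable arrows can be compared pointwise.\<close>

lemma arrow_eventuallyD:
  assumes "(y, g, F) \<in> beta.arrows"
  shows "g \<in> carrier G" "ultrafilter F" "eventually (\<lambda>x. x \<in> carrier G) F"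
    and "eventually P y \<longleftrightarrow> eventually (\<lambda>x. P (g \<otimes> x)) F"
  using assms by (auto simp: beta.mem_arrows_iff topspace_stone_cech ultrafilters_on_def
      stone_cech_action_def eventually_filtermap)

text \<open>Disjointness of the family is used for products: the member containing \<open>x\<close> and \<open>g x\<close> and the
  one containing \<open>g x\<close> and \<open>h g x\<close> share \<open>g x\<close>.\<close>

lemma subgroupoid_family_groupoid:
  assumes \<Y>: "word.disjoint_subspaces \<Y>"
  shows "beta.subgroupoid (family_groupoid \<Y>)"
  unfolding beta.subgroupoid_def
proof (intro conjI allI impI)
  show "family_groupoid \<Y> \<subseteq> beta.arrows" by (auto simp: family_groupoid_def)
  have unique: "Y = Y'" if "Y \<in> \<Y>" "Y' \<in> \<Y>" "x \<in> Y" "x \<in> Y'" for Y Y' x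
    using word.disjoint_subspaces_unique[OF \<Y>] that by blast
  note arrows = beta.subgroupoid_arrows
  fix z h y g F assume a: "(z, h, y) \<in> family_groupoid \<Y> \<and> (y, g, F) \<in> family_groupoid \<Y>"
  then have hy: "(z, h, y) \<in> beta.arrows" "eventually (\<lambda>x. \<exists>Y\<in>\<Y>. x \<in> Y \<and> h \<otimes> x \<in> Y) y"
    and gF: "(y, g, F) \<in> beta.arrows" "eventually (\<lambda>x. \<exists>Y\<in>\<Y>. x \<in> Y \<and> g \<otimes> x \<in> Y) F"
    by (auto simp: family_groupoid_def)
  have "eventually (\<lambda>x. \<exists>Y\<in>\<Y>. g \<otimes> x \<in> Y \<and> h \<otimes> (g \<otimes> x) \<in> Y) F"
    using hy(2) arrow_eventuallyD(4)[OF gF(1)] by simp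
  then have "eventually (\<lambda>x. \<exists>Y\<in>\<Y>. x \<in> Y \<and> h \<otimes> g \<otimes> x \<in> Y) F"
    using gF(2) arrow_eventuallyD(3)[OF gF(1)]
  proof eventually_elim
    case (elim x)
    then show ?case
      using arrow_eventuallyD(1)[OF hy(1)] arrow_eventuallyD(1)[OF gF(1)] unique m_assoc by metis
  qed
  then show "(z, h \<otimes> g, F) \<in> family_groupoid \<Y>"
    using beta.subgroupoid_mult[OF arrows hy(1) gF(1)] by (simp add: family_groupoid_def)
next
  fix y g F assume "(y, g, F) \<in> family_groupoid \<Y>"
  then have gF: "(y, g, F) \<in> beta.arrows" "eventually (\<lambda>x. \<exists>Y\<in>\<Y>. x \<in> Y \<and> g \<otimes> x \<in> Y) F"
    by (auto simp: family_groupoid_def)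
  note arrows = beta.subgroupoid_arrows and D = arrow_eventuallyD[OF gF(1)]
  have *: "eventually (\<lambda>x. \<exists>Y\<in>\<Y>. x \<in> Y \<and> \<one> \<otimes> x \<in> Y) F"
      "eventually (\<lambda>x. \<exists>Y\<in>\<Y>. g \<otimes> x \<in> Y \<and> \<one> \<otimes> (g \<otimes> x) \<in> Y) F"
      "eventually (\<lambda>x. \<exists>Y\<in>\<Y>. g \<otimes> x \<in> Y \<and> inv g \<otimes> (g \<otimes> x) \<in> Y) F"
    by (rule eventually_mono[OF eventually_conj[OF gF(2) D(3)]], use D(1) in \<open>auto simp flip: m_assoc\<close>)+
  show "(F, \<one>, F) \<in> family_groupoid \<Y>"
    using *(1) beta.subgroupoid_source[OF arrows gF(1)] by (simp add: family_groupoid_def)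
  show "(y, \<one>, y) \<in> family_groupoid \<Y>"
    using *(2) beta.subgroupoid_target[OF arrows gF(1)] by (simp add: family_groupoid_def D(4))
  show "(F, inv g, y) \<in> family_groupoid \<Y>"
    using *(3) beta.subgroupoid_inv[OF arrows gF(1)] by (simp add: family_groupoid_def D(4))
qed

text \<open>Subgroupoids of the groupoid of \<open>\<Y>\<close> have to be covered because the subgroupoids generated in a
  decomposition step are in general smaller than the groupoid of the family of neighbourhoods.\<close>

lemma dynamical_class_of_decomposition_class:
  assumes "\<Y> \<in> word.decomposition_class" "beta.open_subgroupoid K" "K \<subseteq> family_groupoid \<Y>"
  shows "K \<in> beta.dynamical_class len"
  using assms
proof (induction arbitrary: K rule: word.decomposition_class.induct)
  case (bounded \<Y>)
  obtain R :: nat where R: "\<And>Y x y. \<lbrakk>Y \<in> \<Y>; x \<in> Y; y \<in> Y\<rbrakk> \<Longrightarrow> length_dist G len x y \<le> real R"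
    using bounded.hyps(2) unfolding word.uniformly_bounded_iff by blast
  have "(\<lambda>(y, g, F). g) ` K \<subseteq> {g \<in> carrier G. len g \<le> R}"
  proof (clarify, intro conjI)
    fix y g F assume "(y, g, F) \<in> K"
    then have gF: "(y, g, F) \<in> beta.arrows" "eventually (\<lambda>x. \<exists>Y\<in>\<Y>. x \<in> Y \<and> g \<otimes> x \<in> Y) F"
      using bounded.prems(2) by (auto simp: family_groupoid_def)
    note D = arrow_eventuallyD[OF gF(1)]
    show "g \<in> carrier G" by (rule D(1))
    have "F \<noteq> bot" using D(2) by (simp add: ultrafilter_def)
    then obtain x Y where "Y \<in> \<Y>" "x \<in> Y" "g \<otimes> x \<in> Y" "x \<in> carrier G"
      using eventually_happens'[OF _ eventually_conj[OF gF(2) D(3)]] by blast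
    then show "len g \<le> R"
      using R length_dist_translate[OF D(1)] by fastforce
  qed
  then have "finite ((\<lambda>(y, g, F). g) ` K)"
    using finite_len_le finite_subset by blast
  moreover have "K \<subseteq> beta.arrows"
    using bounded.prems(1) by (simp add: beta.open_subgroupoid_def beta.subgroupoid_def)
  ultimately have "beta.relatively_compact K"
    using beta.relatively_compact_iff_finite by blast
  then show ?case using bounded.prems(1) beta.dynamical_class.relatively_compact by blast
next
  case (decomposable \<Y>)
  have K: "beta.subgroupoid K" "openin beta.arrow_topology K"
    using decomposable.prems(1) by (simp_all add: beta.open_subgroupoid_def)
  have carrier: "x \<in> carrier G" if "Y \<in> \<Y>" "x \<in> Y" for Y x
    using word.disjoint_subspaces_mem[OF decomposable.hyps(1)] that by blast
  have "beta.decomposable_over len (beta.dynamical_class len) K"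
    unfolding beta.decomposable_over_def
  proof (intro allI impI)
    fix r :: real assume r: "0 \<le> r"
    \<comment> \<open>Neighbourhoods are defined by a strict inequality while the generators may have length
      exactly \<open>r\<close>, hence the radius \<open>r + 1\<close>.\<close>
    let ?C = "word.decomposition_class \<inter> {\<Y>. \<forall>K. beta.open_subgroupoid K \<longrightarrow>
      K \<subseteq> family_groupoid \<Y> \<longrightarrow> K \<in> beta.dynamical_class len}"
    have "\<exists>\<Z>0\<in>?C. \<exists>\<Z>1\<in>?C. \<forall>Y\<in>\<Y>. \<exists>Y0 Y1. Y = Y0 \<union> Y1 \<and>
        word.separated_pieces (r + 1) \<Y> \<Z>0 Y0 \<and> word.separated_pieces (r + 1) \<Y> \<Z>1 Y1"
      using decomposable.IH[unfolded word.decomposable_over_def, THEN spec, of "r + 1"] r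
      by (simp add: Bex_def conj_assoc)
    then obtain \<Z>0 \<Z>1 where "\<Z>0 \<in> ?C" "\<Z>1 \<in> ?C"
      and dec: "\<forall>Y\<in>\<Y>. \<exists>Y0 Y1. Y = Y0 \<union> Y1 \<and>
        word.separated_pieces (r + 1) \<Y> \<Z>0 Y0 \<and> word.separated_pieces (r + 1) \<Y> \<Z>1 Y1"
      by (elim bexE) (rule that)
    then have \<Z>: "\<Z> \<in> ?C" if "\<Z> \<in> {\<Z>0, \<Z>1}" for \<Z>
      using that by (elim insertE) simp_all
    \<comment> \<open>The chosen halves need not be unique; collecting every subset that is a half still
      gives arrows inside the groupoid of \<open>\<Z>\<close>.\<close>
    define part where "part \<Z> = \<Union>{Y'. word.separated_pieces (r + 1) \<Y> \<Z> Y' \<and> (\<exists>Y\<in>\<Y>. Y' \<subseteq> Y)}" for \<Z>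
    define V where "V \<Z> = beta.units_of_subgroupoid K \<inter>
      {F \<in> ultrafilters_on (carrier G). eventually (\<lambda>x. x \<in> part \<Z>) F}" for \<Z>
    have part_carrier: "part \<Z> \<subseteq> carrier G" for \<Z> using carrier by (auto simp: part_def)
    have "openin (stone_cech (carrier G))
        {F \<in> ultrafilters_on (carrier G). eventually (\<lambda>x. x \<in> part \<Z>) F}" for \<Z>
      unfolding openin_stone_cech using part_carrier by auto
    then have openV: "openin (stone_cech (carrier G)) (V \<Z>)" for \<Z>
      unfolding V_def using beta.openin_units[OF decomposable.prems(1)] by (simp add: openin_Int)
    have cover: "beta.units_of_subgroupoid K = V \<Z>0 \<union> V \<Z>1"
    proof
      show "beta.units_of_subgroupoid K \<subseteq> V \<Z>0 \<union> V \<Z>1"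
      proof
        fix F assume F: "F \<in> beta.units_of_subgroupoid K"
        then have gF: "(F, \<one>, F) \<in> beta.arrows" "eventually (\<lambda>x. \<exists>Y\<in>\<Y>. x \<in> Y \<and> \<one> \<otimes> x \<in> Y) F"
          using decomposable.prems(2) by (auto simp: family_groupoid_def beta.units_of_subgroupoid_def)
        note D = arrow_eventuallyD[OF gF(1)]
        have E: "F \<in> ultrafilters_on (carrier G)" using D by (simp add: ultrafilters_on_def)
        have "x \<in> part \<Z>0 \<or> x \<in> part \<Z>1" if Y: "Y \<in> \<Y>" "x \<in> Y" for Y x
        proof -
          obtain Y0 Y1 where halves: "Y = Y0 \<union> Y1"
              "word.separated_pieces (r + 1) \<Y> \<Z>0 Y0" "word.separated_pieces (r + 1) \<Y> \<Z>1 Y1"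
            using bspec[OF dec Y(1)] by (elim exE conjE) (rule that)
          have "\<exists>Y\<in>\<Y>. Y0 \<subseteq> Y" "\<exists>Y\<in>\<Y>. Y1 \<subseteq> Y" using halves(1) Y(1) by blast+
          then have "Y0 \<subseteq> part \<Z>0" "Y1 \<subseteq> part \<Z>1"
            unfolding part_def using halves(2,3) by (intro Union_upper; simp)+
          then show ?thesis using Y(2) halves(1) by blast
        qed
        then have or: "eventually (\<lambda>x. x \<in> part \<Z>0 \<or> x \<in> part \<Z>1) F"
          using gF(2) by (auto elim!: eventually_mono)
        \<comment> \<open>An ultrafilter containing a union of two sets contains one of them.\<close>
        have "eventually (\<lambda>x. x \<in> part \<Z>0) F \<or> eventually (\<lambda>x. x \<in> part \<Z>1) F"
        proof (rule disjCI)
          assume "\<not> eventually (\<lambda>x. x \<in> part \<Z>1) F"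
          then have "eventually (\<lambda>x. x \<notin> part \<Z>1) F" using ultrafilter_not_iff[OF D(2)] by blast
          then show "eventually (\<lambda>x. x \<in> part \<Z>0) F" using or by eventually_elim blast
        qed
        then show "F \<in> V \<Z>0 \<union> V \<Z>1" using F E by (auto simp: V_def)
      qed
    qed (auto simp: V_def)
    have "beta.generated_subgroupoid {(y, g, F) \<in> K. F \<in> V \<Z> \<and> real (len g) \<le> r}
        \<in> beta.dynamical_class len" if \<Z>_in: "\<Z> \<in> {\<Z>0, \<Z>1}" for \<Z>
    proof -
      let ?S = "{(y, g, F) \<in> K. F \<in> V \<Z> \<and> real (len g) \<le> r}"
      have "beta.open_subgroupoid (beta.generated_subgroupoid ?S)"
      proof (rule beta.open_subgroupoid_generated[OF K(1)])
        show "openin beta.arrow_topology ?S"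
          using beta.openin_arrows_source[OF K(2) openV, of \<Z> "\<lambda>g. real (len g) \<le> r"] by simp
      qed auto
      moreover have "?S \<subseteq> family_groupoid \<Z>"
      proof clarify
        fix y g F assume a: "(y, g, F) \<in> K" "F \<in> V \<Z>" "real (len g) \<le> r"
        then have gF: "(y, g, F) \<in> beta.arrows" "eventually (\<lambda>x. \<exists>Y\<in>\<Y>. x \<in> Y \<and> g \<otimes> x \<in> Y) F"
          using decomposable.prems(2) by (auto simp: family_groupoid_def)
        have "eventually (\<lambda>x. x \<in> part \<Z>) F" using a(2) by (simp add: V_def)
        then have "eventually (\<lambda>x. \<exists>Z\<in>\<Z>. x \<in> Z \<and> g \<otimes> x \<in> Z) F"
          using gF(2)
        proof eventually_elim
          case (elim x)
          then obtain Y where Y: "Y \<in> \<Y>" "x \<in> Y" "g \<otimes> x \<in> Y" by blast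
          from elim obtain Y' Y1 where Y': "word.separated_pieces (r + 1) \<Y> \<Z> Y'" "x \<in> Y'"
            by (auto simp: part_def)
          then obtain W where W: "x \<in> W" "word.family_nbhd (r + 1) \<Y> W \<in> \<Z>"
            by (auto simp: word.separated_pieces_def)
          have x: "x \<in> carrier G" using carrier Y by blast
          have "length_dist G len (g \<otimes> x) x < r + 1" "length_dist G len x x < r + 1"
            using length_dist_translate[OF arrow_eventuallyD(1)[OF gF(1)] x] a(3) r
              word.zero[OF x x] by simp_all
          then have "word.family_dist \<Y> (g \<otimes> x) x < ereal (r + 1)" "word.family_dist \<Y> x x < ereal (r + 1)"
            using Y by (auto simp: word.family_dist_def)
          then have "x \<in> word.family_nbhd (r + 1) \<Y> W" "g \<otimes> x \<in> word.family_nbhd (r + 1) \<Y> W"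
            using Y W(1) by (auto simp: word.family_nbhd_def)
          then show ?case using W(2) by blast
        qed
        then show "(y, g, F) \<in> family_groupoid \<Z>" using gF(1) by (simp add: family_groupoid_def)
      qed
      moreover have "word.disjoint_subspaces \<Z>"
        using \<Z>[OF \<Z>_in] word.decomposition_class.cases by blast
      ultimately show ?thesis
        using \<Z>[OF \<Z>_in] beta.generated_subgroupoid_subset[OF subgroupoid_family_groupoid, of \<Z> ?S]
        by blast
    qed
    note generated = this
    show "\<exists>U0 U1. openin (stone_cech (carrier G)) U0 \<and> openin (stone_cech (carrier G)) U1 \<and>
        beta.units_of_subgroupoid K = U0 \<union> U1 \<and>
        (\<forall>U\<in>{U0, U1}. beta.generated_subgroupoid {(y, g, F) \<in> K. F \<in> U \<and> real (len g) \<le> r}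
          \<in> beta.dynamical_class len)"
    proof (intro exI conjI ballI)
      show "beta.units_of_subgroupoid K = V \<Z>0 \<union> V \<Z>1" by (rule cover)
      fix U assume "U \<in> {V \<Z>0, V \<Z>1}"
      then obtain \<Z> where "\<Z> \<in> {\<Z>0, \<Z>1}" "U = V \<Z>" by blast
      then show "beta.generated_subgroupoid {(y, g, F) \<in> K. F \<in> U \<and> real (len g) \<le> r}
          \<in> beta.dynamical_class len"
        using generated by simp
    qed (rule openV)+
  qed
  with decomposable.prems(1) show ?case by (rule beta.dynamical_class.decomposable)
qed

lemma arrows_subset_family_groupoid: "beta.arrows \<subseteq> family_groupoid {carrier G}"
proof clarify
  fix y g F assume a: "(y, g, F) \<in> beta.arrows"
  have "eventually (\<lambda>x. x \<in> carrier G \<and> g \<otimes> x \<in> carrier G) F"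
    using arrow_eventuallyD(3)[OF a] by (rule eventually_mono) (simp add: arrow_eventuallyD(1)[OF a])
  then show "(y, g, F) \<in> family_groupoid {carrier G}" using a by (simp add: family_groupoid_def)
qed

end


section \<open>The equivalence\<close>

theorem theoremA3:
  fixes G :: "('a, 'b) monoid_scheme" and len :: "'a \<Rightarrow> nat"
  assumes "group G" and "countable (carrier G)"
    and "proper_length_function G len"
  shows "Metric_space.finite_decomposition_complexity (carrier G) (length_dist G len) \<longleftrightarrow>
    compact_Hausdorff_action.finite_dynamical_complexity G
      (stone_cech (carrier G)) (stone_cech_action G) len"
proof -
  interpret proper_length_function G len by (rule assms(3))
  have "word.disjoint_subspaces {carrier G}"
    by (auto simp: word.disjoint_subspaces_def disjoint_def)
  then have "{carrier G} \<in> word.decomposition_class \<longleftrightarrow> beta.arrows \<in> beta.dynamical_class len"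
    using dynamical_class_of_decomposition_class[OF _ beta.open_subgroupoid_arrows
        arrows_subset_family_groupoid]
      decomposition_class_of_dynamical_class[of beta.arrows "{carrier G}"] orbit_arrow_in_arrows
    by blast
  then show ?thesis
    by (simp add: word.finite_decomposition_complexity_def beta.finite_dynamical_complexity_def)
qed

end
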